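(* Let $k\in\{1,2\}$ and let $\{\psi^n_m : n\ge 0,\ m\in J_n\}$, with finite index sets $J_n$ satisfying $|J_n|\asymp 2^{dn}$, be a multiresolution family of functions on $D$ which has the $k$-orthogonality property (defined in the context) with respect to the triangulations $\{\mathcal{T}_\ell:\ell\ge 0\}$. Enumerate the family level-wise as $\{\psi_j : j\ge 1\}$ (all functions with $n=0$ first, then those with $n=1$, then $n=2$, and so on), and let $\{y_j:j\ge1\}=\{y^n_m: n\ge 0,\ m\in J_n\}$ be the corresponding enumeration of the parameters, so that the parametric coefficient is $$a(\boldsymbol{x},\boldsymbol{y})=\bar a(\boldsymbol{x})+\sum_{j\ge 1}y_j\psi_j(\boldsymbol{x})=\bar a(\boldsymbol{x})+\sum_{n=0}^\infty\sum_{m\in J_n}y^n_m\,\psi^n_m(\boldsymbol{x}).$$ Suppose $\bar a\in L^\infty(D)$, $\sum_{j\ge1}\|\psi_j\|_{L^\infty(D)}<\infty$, and $0<a_{\min}\le a(\boldsymbol{x},\boldsymbol{y})\le a_{\max}$ for all $\boldsymbol{x}\in D$, $\boldsymbol{y}\in U$. Define $$s_\ell:=\sum_{n=0}^{\ell+k-1}|J_n| ,\qquad \ell\ge 0 .$$ Then $s_\ell\asymp 2^{d\ell}\asymp M_{h_\ell}$, and for all $\ell\ge0$ (and all $\boldsymbol{y}\in U$) $$u_{h_\ell}=u_{h_\ell}^{s_\ell}.$$ Moreover, as $\ell\to\infty$, the number of nonzero entries of the finite element stiffness matrix for the coefficient $a(\cdot,\boldsymbol{y})$ at mesh level $\ell$,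 for any given $\boldsymbol{y}\in U$, is $\mathcal{O}(M_{h_\ell})$; under the assumption that each nonzero entry can be computed in $\mathcal{O}(\log(M_{h_\ell}))$ operations, the total cost of computing the stiffness matrix is $\mathcal{O}(M_{h_\ell}\log(M_{h_\ell}))$ operations.
   Context: Notation: $a_n\asymp b_n$ means there are $c_1,c_2>0$ with $c_1b_n\le a_n\le c_2b_n$ for all $n$. $D\subset\mathbb{R}^d$, $d\in\{1,2,3\}$, is a bounded polyhedral domain with Lipschitz boundary, $V=H^1_0(D)$, $f\in V^*$, $U=[-\frac12,\frac12]^{\mathbb{N}}$. Bilinear form: $b(\boldsymbol{y};w,v)=\int_D a(\boldsymbol{x},\boldsymbol{y})\nabla w(\boldsymbol{x})\cdot\nabla v(\boldsymbol{x})\,d\boldsymbol{x}$. Finite elements: $\{\mathcal{T}_\ell\}_{\ell\ge0}$ is a sequence of regular simplicial meshes of $D$ obtained from an initial regular triangulation $\mathcal{T}_0$ by recursive uniform refinement, with mesh widths $h_\ell=2^{-\ell}h_0$. For a mesh $\mathcal{T}$, with $P^r(K)$ the polynomials of degree at most $r$ on $K$, $$S^0(D,\mathcal{T})=\{v\in L^2(D): v|_K\in P^0(K)\ \forall K\in\mathcal{T}\},\quad S^1(D,\mathcal{T})=\{v\in H^1_0(D): v|_K\in P^1(K)\ \forall K\in\mathcal{T}\}.$$ $V_{h_\ell}=S^1(D,\mathcal{T}_\ell)$; these spaces are nested and $M_{h_\ell}:=\dim V_{h_\ell}\asymp2^{d\ell}$. The stiffness matrix at level $\ell$ is $\big(b(\boldsymbol{y};\phi^\ell_i,\phi^\ell_{i'})\big)_{i,i'}$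 with $\{\phi_i^\ell\}$ the nodal hat basis of $V_{h_\ell}$. The finite element solution $u_{h_\ell}(\cdot,\boldsymbol{y})\in V_{h_\ell}$ is defined by $b(\boldsymbol{y};u_{h_\ell}(\cdot,\boldsymbol{y}),v)=(f,v)$ for all $v\in V_{h_\ell}$, and $u^{s}_{h_\ell}(\cdot,\boldsymbol{y}):=u_{h_\ell}(\cdot,(y_1,\dots,y_s,0,0,\dots))$ is the finite element solution when the coefficient expansion is truncated after $s$ terms. $k$-orthogonality property: the set $\{\psi^n_m\}_{n\ge0,m\in J_n}$ has the $k$-orthogonality property, $k\in\{1,2\}$, with respect to $\{\mathcal{T}_\ell:\ell\ge0\}$ if for all $\ell\ge0$ $$\int_D\psi^n_m(\boldsymbol{x})z_\ell(\boldsymbol{x})\,d\boldsymbol{x}=0\quad\text{for all } n\ge\ell+k,\ m\in J_n,\ z_\ell\in S^0(D,\mathcal{T}_\ell),$$ and $\psi^n_m\in S^{k-1}(D,\mathcal{T}_{\ell+k-1})$ for all $n\le\ell+k-1$, $m\in J_n$, and $\mathrm{diam}(\mathrm{supp}(\psi^n_m))\asymp h_n$. In a multiresolution family, $n$ is the level index, $m\in J_n$ is the location index, the functions at level $n$ are piecewise polynomial on $\mathcal{T}_n$ and have isotropic supports of diameter of exact order $h_n$. *)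

theory Defs
  imports
    "HOL-Analysis.Analysis"
    "HOL-Probability.Essential_Supremum"
    "HOL-Library.Function_Algebras"
    "HOL-Library.Landau_Symbols"
begin

section \<open>Lebesgue and Sobolev spaces on a domain\<close>

text \<open>
  Functions on \<open>D\<close> are represented by total functions on the ambient Euclidean space; in this
  section only their values on \<open>D\<close> (up to null sets) matter.
\<close>

definition L2 :: "'a::euclidean_space set \<Rightarrow> ('a \<Rightarrow> 'b::euclidean_space) set" where
  "L2 D = {v. v \<in> borel_measurable (lebesgue_on D) \<and>
              integrable (lebesgue_on D) (\<lambda>x. (norm (v x))\<^sup>2)}"

definition Linf_norm :: "'a::euclidean_space set \<Rightarrow> ('a \<Rightarrow> real) \<Rightarrow> ereal" where
  "Linf_norm D v = esssup (lebesgue_on D) (\<lambda>x. ereal \<bar>v x\<bar>)"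

definition Linf :: "'a::euclidean_space set \<Rightarrow> ('a \<Rightarrow> real) set" where
  "Linf D = {v. v \<in> borel_measurable (lebesgue_on D) \<and> Linf_norm D v < \<infinity>}"

primrec C_k :: "nat \<Rightarrow> ('a::euclidean_space \<Rightarrow> real) \<Rightarrow> bool" where
  "C_k 0 v \<longleftrightarrow> continuous_on UNIV v"
| "C_k (Suc n) v \<longleftrightarrow>
     (\<exists>g. (\<forall>x. GDERIV v x :> g x) \<and> (\<forall>b\<in>Basis. C_k n (\<lambda>x. g x \<bullet> b)))"

definition test_functions :: "'a::euclidean_space set \<Rightarrow> ('a \<Rightarrow> real) set" where
  "test_functions D =
     {\<phi>. (\<forall>n. C_k n \<phi>) \<and> compact (closure {x. \<phi> x \<noteq> 0}) \<and> closure {x. \<phi> x \<noteq> 0} \<subseteq> D}"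

definition has_weak_gradient ::
    "'a::euclidean_space set \<Rightarrow> ('a \<Rightarrow> real) \<Rightarrow> ('a \<Rightarrow> 'a) \<Rightarrow> bool" where
  "has_weak_gradient D v G \<longleftrightarrow> G \<in> L2 D \<and>
     (\<forall>\<phi>\<in>test_functions D. \<forall>g. (\<forall>x. GDERIV \<phi> x :> g x) \<longrightarrow>
        (\<forall>b\<in>Basis. (\<integral>x. v x * (g x \<bullet> b) \<partial>lebesgue_on D)
                  = - (\<integral>x. (G x \<bullet> b) * \<phi> x \<partial>lebesgue_on D)))"

definition weak_gradient :: "'a::euclidean_space set \<Rightarrow> ('a \<Rightarrow> real) \<Rightarrow> 'a \<Rightarrow> 'a" where
  "weak_gradient D v = (SOME G. has_weak_gradient D v G)"

definition H1 :: "'a::euclidean_space set \<Rightarrow> ('a \<Rightarrow> real) set" where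
  "H1 D = {v \<in> L2 D. \<exists>G. has_weak_gradient D v G}"

definition H1_norm :: "'a::euclidean_space set \<Rightarrow> ('a \<Rightarrow> real) \<Rightarrow> real" where
  "H1_norm D v = sqrt ((\<integral>x. (v x)\<^sup>2 \<partial>lebesgue_on D)
                     + (\<integral>x. (norm (weak_gradient D v x))\<^sup>2 \<partial>lebesgue_on D))"

definition H1_0 :: "'a::euclidean_space set \<Rightarrow> ('a \<Rightarrow> real) set" where
  "H1_0 D = {v \<in> H1 D. \<exists>\<phi>. (\<forall>n::nat. \<phi> n \<in> test_functions D) \<and>
                          (\<lambda>n. H1_norm D (\<lambda>x. v x - \<phi> n x)) \<longlonglongrightarrow> 0}"

definition dual_H1_0 :: "'a::euclidean_space set \<Rightarrow> (('a \<Rightarrow> real) \<Rightarrow> real) set" where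
  "dual_H1_0 D = {f.
     (\<forall>u\<in>H1_0 D. \<forall>v\<in>H1_0 D. f (\<lambda>x. u x + v x) = f u + f v) \<and>
     (\<forall>c. \<forall>v\<in>H1_0 D. f (\<lambda>x. c * v x) = c * f v) \<and>
     (\<exists>C. \<forall>v\<in>H1_0 D. \<bar>f v\<bar> \<le> C * H1_norm D v)}"


section \<open>Domains and meshes\<close>

text \<open>The last clause says that near a boundary point \<open>D\<close> is, in the direction \<open>e\<close>, the strict
  epigraph of a Lipschitz function of the components orthogonal to \<open>e\<close>.\<close>

definition lipschitz_domain :: "'a::euclidean_space set \<Rightarrow> bool" where
  "lipschitz_domain D \<longleftrightarrow> open D \<and> connected D \<and> D \<noteq> {} \<and>
     (\<forall>x\<in>frontier D. \<exists>r>0. \<exists>e L \<gamma>. norm e = 1 \<and> L-lipschitz_on UNIV \<gamma> \<and>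
        D \<inter> ball x r = {z \<in> ball x r. \<gamma> (z - (z \<bullet> e) *\<^sub>R e) < z \<bullet> e})"

definition polyhedral :: "'a::euclidean_space set \<Rightarrow> bool" where
  "polyhedral D \<longleftrightarrow> (\<exists>F. finite F \<and> (\<forall>P\<in>F. polytope P) \<and> closure D = \<Union>F)"

definition simplicial_mesh :: "'a::euclidean_space set \<Rightarrow> 'a set set \<Rightarrow> bool" where
  "simplicial_mesh D T \<longleftrightarrow>
     triangulation T \<and> (\<forall>K\<in>T. int DIM('a) simplex K) \<and> \<Union>T = closure D"

definition vertices :: "'a::euclidean_space set \<Rightarrow> 'a set" where
  "vertices K = {v. v extreme_point_of K}"

text \<open>
  Every simplex is cut into \<open>2 ^ d\<close> simplices whose vertices are vertices or edge midpoints
  (\<open>midpoint v v = v\<close>) of the parent, among them the \<open>d + 1\<close> corner simplices. For \<open>d = 1, 2\<close>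
  this determines the refinement; for \<open>d = 3\<close> it leaves free which diagonal splits the inner
  octahedron.
\<close>

definition uniform_refinement :: "'a::euclidean_space set set \<Rightarrow> 'a set set \<Rightarrow> bool" where
  "uniform_refinement T T' \<longleftrightarrow>
     (\<forall>K'\<in>T'. \<exists>K\<in>T. K' \<subseteq> K) \<and>
     (\<forall>K\<in>T. card {K'\<in>T'. K' \<subseteq> K} = 2 ^ DIM('a) \<and> \<Union>{K'\<in>T'. K' \<subseteq> K} = K \<and>
        (\<forall>K'\<in>T'. K' \<subseteq> K \<longrightarrow>
           vertices K' \<subseteq> {midpoint v w | v w. v \<in> vertices K \<and> w \<in> vertices K}) \<and>
        (\<forall>v\<in>vertices K. convex hull (midpoint v ` vertices K) \<in> T'))"

definition mesh_width :: "(nat \<Rightarrow> 'a::euclidean_space set set) \<Rightarrow> nat \<Rightarrow> real" where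
  "mesh_width T l = Max (diameter ` T 0) / 2 ^ l"

text \<open>
  The last clause is shape regularity together with the statement that the simplices of level
  \<open>l\<close> have diameter of exact order \<open>mesh_width T l\<close>. The maximal diameter of \<open>T l\<close> is equal to
  \<open>mesh_width T l\<close> if \<open>d = 1, 2\<close>, but need not be if \<open>d = 3\<close>, since the diagonal of the inner
  octahedron may be longer than half the longest edge; the equality is therefore not required.
\<close>

definition mesh_sequence :: "'a::euclidean_space set \<Rightarrow> (nat \<Rightarrow> 'a set set) \<Rightarrow> bool" where
  "mesh_sequence D T \<longleftrightarrow>
     (\<forall>l. simplicial_mesh D (T l)) \<and>
     (\<forall>l. uniform_refinement (T l) (T (Suc l))) \<and>
     (\<exists>\<kappa>>0. \<forall>l. \<forall>K\<in>T l.
        diameter K \<le> \<kappa> * mesh_width T l \<and> (\<exists>x. cball x (mesh_width T l / \<kappa>) \<subseteq> K))"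


section \<open>Finite elements\<close>

definition S0 :: "'a::euclidean_space set \<Rightarrow> 'a set set \<Rightarrow> ('a \<Rightarrow> real) set" where
  "S0 D T = {v \<in> L2 D. \<forall>K\<in>T. \<exists>c. AE x in lebesgue_on K. v x = c}"

text \<open>
  An element of \<open>S\<^sup>1(D, T)\<close> is represented by its continuous representative, extended by \<open>0\<close>
  outside \<open>D\<close>. Hence equality of elements is equality of functions, and point values at the
  vertices make sense.
\<close>

definition S1 :: "'a::euclidean_space set \<Rightarrow> 'a set set \<Rightarrow> ('a \<Rightarrow> real) set" where
  "S1 D T = {v \<in> H1_0 D. (\<forall>K\<in>T. \<exists>c g. \<forall>x\<in>K. v x = c + g \<bullet> x) \<and> (\<forall>x. x \<notin> D \<longrightarrow> v x = 0)}"

definition S_space ::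
    "nat \<Rightarrow> 'a::euclidean_space set \<Rightarrow> 'a set set \<Rightarrow> ('a \<Rightarrow> real) set" where
  "S_space r D T = (if r = 0 then S0 D T else S1 D T)"

definition fe_dim :: "'a::euclidean_space set \<Rightarrow> 'a set set \<Rightarrow> nat" where
  "fe_dim D T = vector_space.dim (\<lambda>(c::real) v x. c * v x) (S1 D T)"

definition bilinear_form ::
    "'a::euclidean_space set \<Rightarrow> ('a \<Rightarrow> real) \<Rightarrow> ('a \<Rightarrow> real) \<Rightarrow> ('a \<Rightarrow> real) \<Rightarrow> real" where
  "bilinear_form D a w v =
     (\<integral>x. a x * (weak_gradient D w x \<bullet> weak_gradient D v x) \<partial>lebesgue_on D)"

text \<open>Existence and uniqueness are the Lax--Milgram lemma when \<open>a\<close> is bounded and bounded away from \<open>0\<close>.\<close>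

definition fe_solution ::
    "'a::euclidean_space set \<Rightarrow> 'a set set \<Rightarrow> (('a \<Rightarrow> real) \<Rightarrow> real) \<Rightarrow> ('a \<Rightarrow> real) \<Rightarrow> 'a \<Rightarrow> real" where
  "fe_solution D T f a = (THE u. u \<in> S1 D T \<and> (\<forall>v\<in>S1 D T. bilinear_form D a u v = f v))"

definition interior_nodes :: "'a::euclidean_space set \<Rightarrow> 'a set set \<Rightarrow> 'a set" where
  "interior_nodes D T = (\<Union>K\<in>T. vertices K) \<inter> D"

definition nodal_basis ::
    "'a::euclidean_space set \<Rightarrow> 'a set set \<Rightarrow> ('a \<Rightarrow> 'a \<Rightarrow> real) \<Rightarrow> bool" where
  "nodal_basis D T \<phi> \<longleftrightarrow>
     (\<forall>p\<in>interior_nodes D T. \<phi> p \<in> S1 D T \<and>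
        (\<forall>q\<in>interior_nodes D T. \<phi> p q = (if q = p then 1 else 0)))"

definition stiffness_matrix ::
    "'a::euclidean_space set \<Rightarrow> ('a \<Rightarrow> 'a \<Rightarrow> real) \<Rightarrow> ('a \<Rightarrow> real) \<Rightarrow> 'a \<Rightarrow> 'a \<Rightarrow> real" where
  "stiffness_matrix D \<phi> a p q = bilinear_form D a (\<phi> p) (\<phi> q)"

definition nonzero_entries ::
    "'a::euclidean_space set \<Rightarrow> 'a set set \<Rightarrow> ('a \<Rightarrow> 'a \<Rightarrow> real) \<Rightarrow> ('a \<Rightarrow> real) \<Rightarrow> ('a \<times> 'a) set" where
  "nonzero_entries D T \<phi> a =
     {(p, q) \<in> interior_nodes D T \<times> interior_nodes D T. stiffness_matrix D \<phi> a p q \<noteq> 0}"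


section \<open>Multiresolution families and the parametric coefficient\<close>

definition same_order_on :: "'i set \<Rightarrow> ('i \<Rightarrow> real) \<Rightarrow> ('i \<Rightarrow> real) \<Rightarrow> bool" where
  "same_order_on I a b \<longleftrightarrow> (\<exists>c1>0. \<exists>c2>0. \<forall>i\<in>I. c1 * b i \<le> a i \<and> a i \<le> c2 * b i)"

definition supp :: "'a::euclidean_space set \<Rightarrow> ('a \<Rightarrow> real) \<Rightarrow> 'a set" where
  "supp D v = closure {x \<in> D. v x \<noteq> 0}"

definition supports_of_mesh_order ::
    "'a::euclidean_space set \<Rightarrow> (nat \<Rightarrow> 'a set set) \<Rightarrow> (nat \<Rightarrow> 'm set) \<Rightarrow>
     (nat \<Rightarrow> 'm \<Rightarrow> 'a \<Rightarrow> real) \<Rightarrow> bool" where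
  "supports_of_mesh_order D T J \<psi> \<longleftrightarrow>
     same_order_on (Sigma UNIV J) (\<lambda>(n, m). diameter (supp D (\<psi> n m))) (\<lambda>(n, m). mesh_width T n)"

text \<open>
  Isotropy of the supports: up to a uniform constant, every support contains a ball as large as
  its diameter.
\<close>

definition multiresolution_family ::
    "'a::euclidean_space set \<Rightarrow> (nat \<Rightarrow> 'a set set) \<Rightarrow> (nat \<Rightarrow> 'm set) \<Rightarrow>
     (nat \<Rightarrow> 'm \<Rightarrow> 'a \<Rightarrow> real) \<Rightarrow> bool" where
  "multiresolution_family D T J \<psi> \<longleftrightarrow>
     (\<forall>n. \<forall>m\<in>J n. \<forall>K\<in>T n. \<exists>P. real_polynomial_function P \<and>
        (AE x in lebesgue_on K. \<psi> n m x = P x)) \<and>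
     supports_of_mesh_order D T J \<psi> \<and>
     (\<exists>c>0. \<forall>n. \<forall>m\<in>J n. \<exists>x. cball x (c * diameter (supp D (\<psi> n m))) \<subseteq> supp D (\<psi> n m))"

definition k_orthogonality ::
    "nat \<Rightarrow> 'a::euclidean_space set \<Rightarrow> (nat \<Rightarrow> 'a set set) \<Rightarrow> (nat \<Rightarrow> 'm set) \<Rightarrow>
     (nat \<Rightarrow> 'm \<Rightarrow> 'a \<Rightarrow> real) \<Rightarrow> bool" where
  "k_orthogonality k D T J \<psi> \<longleftrightarrow>
     (\<forall>l. (\<forall>n\<ge>l + k. \<forall>m\<in>J n. \<forall>z\<in>S0 D (T l). (\<integral>x. \<psi> n m x * z x \<partial>lebesgue_on D) = 0) \<and>
          (\<forall>n\<le>l + k - 1. \<forall>m\<in>J n. \<psi> n m \<in> S_space (k - 1) D (T (l + k - 1)))) \<and>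
     supports_of_mesh_order D T J \<psi>"

text \<open>
  Enumerations start at index \<open>0\<close>: \<open>\<psi>\<^sub>j\<close> and \<open>y\<^sub>j\<close> with \<open>j \<ge> 1\<close> correspond to index \<open>j - 1\<close> below.
\<close>

definition levelwise_enumeration :: "(nat \<Rightarrow> 'm set) \<Rightarrow> (nat \<Rightarrow> nat \<times> 'm) \<Rightarrow> bool" where
  "levelwise_enumeration J e \<longleftrightarrow> bij_betw e UNIV (Sigma UNIV J) \<and> mono (\<lambda>j. fst (e j))"

definition enumerated ::
    "(nat \<Rightarrow> 'm \<Rightarrow> 'a \<Rightarrow> real) \<Rightarrow> (nat \<Rightarrow> nat \<times> 'm) \<Rightarrow> nat \<Rightarrow> 'a \<Rightarrow> real" where
  "enumerated \<psi> e j = \<psi> (fst (e j)) (snd (e j))"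

definition param_domain :: "(nat \<Rightarrow> real) set" where
  "param_domain = {y. \<forall>j. y j \<in> {-1/2..1/2}}"

definition truncate :: "nat \<Rightarrow> (nat \<Rightarrow> real) \<Rightarrow> nat \<Rightarrow> real" where
  "truncate s y = (\<lambda>j. if j < s then y j else 0)"

definition coefficient ::
    "('a \<Rightarrow> real) \<Rightarrow> (nat \<Rightarrow> 'a \<Rightarrow> real) \<Rightarrow> (nat \<Rightarrow> real) \<Rightarrow> 'a \<Rightarrow> real" where
  "coefficient abar \<psi> y x = abar x + (\<Sum>j. y j * \<psi> j x)"

definition truncation_dim :: "nat \<Rightarrow> (nat \<Rightarrow> 'm set) \<Rightarrow> nat \<Rightarrow> nat" where
  "truncation_dim k J l = (\<Sum>n=0..l + k - 1. card (J n))"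

end

theory Submission
  imports Defs "HOL-Computational_Algebra.Polynomial"
begin

text \<open>
  On every cell the gradient of an element of \<open>S\<^sup>1(D, \<T>\<^sub>\<ell>)\<close> is constant, so the integrand
  \<open>\<nabla>w \<bullet> \<nabla>v\<close> of the bilinear form lies in \<open>S\<^sup>0(D, \<T>\<^sub>\<ell>)\<close>. By \<open>k\<close>-orthogonality all terms
  \<open>y\<^sub>j \<psi>\<^sub>j\<close> of level at least \<open>\<ell> + k\<close>, that is with \<open>j\<close> beyond \<open>s\<^sub>\<ell>\<close>, integrate to \<open>0\<close> against it.
  Hence the full and the truncated coefficient define the same bilinear form on
  \<open>S\<^sup>1(D, \<T>\<^sub>\<ell>)\<close>, and therefore the same Galerkin solution.
  Weak gradients are only determined by testing with smooth functions, so that their constancy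
  rests on the fundamental lemma of the calculus of variations. The dimension of \<open>S\<^sup>1(D, \<T>\<^sub>\<ell>)\<close> is
  the number of interior nodes. It is at most of the order of the number \<open>|\<T>\<^sub>0| 2\<^bsup>d\<ell>\<^esup>\<close> of cells, and
  at least of this order by a volume argument. A stiffness matrix entry vanishes unless its
  two nodes share a cell.
\<close>

section \<open>Smooth test functions\<close>

lemma C_k_const: "C_k n (\<lambda>x. c)"
proof (induction n arbitrary: c)
  case (Suc n)
  show ?case
    by (auto intro!: exI[of _ "\<lambda>x. 0"] GDERIV_const Suc)
qed auto

lemma C_k_SucI:
  assumes "\<And>x. GDERIV v x :> g x" "\<And>b. b \<in> Basis \<Longrightarrow> C_k n (\<lambda>x. g x \<bullet> b)"
  shows "C_k (Suc n) v"
  using assms by auto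

lemma C_k_SucE:
  assumes "C_k (Suc n) v"
  obtains g where "\<And>x. GDERIV v x :> g x" "\<And>b. b \<in> Basis \<Longrightarrow> C_k n (\<lambda>x. g x \<bullet> b)"
  using assms by auto

lemma C_k_SucD: "C_k (Suc n) v \<Longrightarrow> C_k n v"
proof (induction n arbitrary: v)
  case 0
  then obtain g where "\<And>x. GDERIV v x :> g x" by auto
  then have "continuous (at x) v" for x
    unfolding gderiv_def by (blast intro: has_derivative_continuous)
  then show ?case by (simp add: continuous_at_imp_continuous_on)
next
  case (Suc n)
  from Suc.prems obtain g where "\<And>x. GDERIV v x :> g x" "\<And>b. b \<in> Basis \<Longrightarrow> C_k (Suc n) (\<lambda>x. g x \<bullet> b)"
    by auto
  with Suc.IH show ?case by (intro C_k_SucI) auto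
qed

lemma C_k_add: "C_k n v \<Longrightarrow> C_k n w \<Longrightarrow> C_k n (\<lambda>x. v x + w x)"
proof (induction n arbitrary: v w)
  case (Suc n)
  obtain g where "\<And>x. GDERIV v x :> g x" "\<And>b. b \<in> Basis \<Longrightarrow> C_k n (\<lambda>x. g x \<bullet> b)"
    using Suc.prems(1) by (elim C_k_SucE) blast
  moreover obtain h where
    "\<And>x. GDERIV w x :> h x" "\<And>b. b \<in> Basis \<Longrightarrow> C_k n (\<lambda>x. h x \<bullet> b)"
    using Suc.prems(2) by (elim C_k_SucE) blast
  ultimately show ?case
    by (intro C_k_SucI[of _ "\<lambda>x. g x + h x"]) (auto intro: GDERIV_add Suc.IH simp: inner_add_left)
qed (auto intro: continuous_on_add)

lemma C_k_mult: "C_k n v \<Longrightarrow> C_k n w \<Longrightarrow> C_k n (\<lambda>x. v x * w x)"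
proof (induction n arbitrary: v w)
  case (Suc n)
  obtain g where "\<And>x. GDERIV v x :> g x" "\<And>b. b \<in> Basis \<Longrightarrow> C_k n (\<lambda>x. g x \<bullet> b)"
    using Suc.prems(1) by (elim C_k_SucE) blast
  moreover obtain h where
    "\<And>x. GDERIV w x :> h x" "\<And>b. b \<in> Basis \<Longrightarrow> C_k n (\<lambda>x. h x \<bullet> b)"
    using Suc.prems(2) by (elim C_k_SucE) blast
  moreover have "C_k n v" "C_k n w"
    using Suc.prems by (blast dest: C_k_SucD)+
  ultimately show ?case
    by (intro C_k_SucI[of _ "\<lambda>x. v x *\<^sub>R h x + w x *\<^sub>R g x"])
       (auto intro: GDERIV_mult intro!: Suc.IH C_k_add simp: inner_add_left)
qed (auto intro: continuous_on_mult)

lemma C_k_prod: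
  assumes "finite I" "\<And>i. i \<in> I \<Longrightarrow> C_k n (v i)"
  shows "C_k n (\<lambda>x. \<Prod>i\<in>I. v i x)"
  using assms by (induction I rule: finite_induct) (auto intro: C_k_const C_k_mult)

lemma C_k_affine: "C_k n (\<lambda>x. c + x \<bullet> g)"
proof (cases n)
  case (Suc m)
  have "GDERIV (\<lambda>x. c + x \<bullet> g) x :> g" for x
    unfolding gderiv_def by (auto intro!: derivative_eq_intros)
  then show ?thesis
    unfolding Suc by (intro C_k_SucI) (auto intro: C_k_const)
qed (auto intro!: continuous_intros)

text \<open>The chain rule produces \<open>h' (v x)\<close> times the gradient of \<open>v\<close>,
  so the induction has to run over all \<open>h\<close> in a family \<open>P\<close> closed under
  differentiation. The instances used are \<open>{exp}\<close> and the range of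
  \<open>exp_inv\<close>.\<close>

lemma C_k_compose:
  assumes "\<And>h. h \<in> P \<Longrightarrow> \<exists>h'\<in>P. \<forall>t. (h has_real_derivative h' t) (at t)"
    and "h \<in> P" and "C_k n v"
  shows "C_k n (\<lambda>x. h (v x))"
  using assms(2,3)
proof (induction n arbitrary: h)
  case 0
  from assms(1)[OF 0(1)] have "continuous_on UNIV h"
    by (meson DERIV_continuous continuous_at_imp_continuous_on)
  with 0 show ?case by (auto intro: continuous_on_compose2)
next
  case (Suc n)
  obtain g where g: "\<And>x. GDERIV v x :> g x" "\<And>b. b \<in> Basis \<Longrightarrow> C_k n (\<lambda>x. g x \<bullet> b)"
    using Suc.prems by auto
  obtain h' where h': "h' \<in> P" "\<And>t. (h has_real_derivative h' t) (at t)"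
    using assms(1)[OF Suc.prems(1)] by auto
  show ?case
  proof (intro C_k_SucI[of _ "\<lambda>x. h' (v x) *\<^sub>R g x"])
    show "GDERIV (\<lambda>x. h (v x)) x :> h' (v x) *\<^sub>R g x" for x
      using g(1) h'(2) by (rule GDERIV_DERIV_compose)
    show "C_k n (\<lambda>x. (h' (v x) *\<^sub>R g x) \<bullet> b)" if "b \<in> Basis" for b
      using Suc.IH[OF h'(1) C_k_SucD[OF Suc.prems(2)]] g(2)[OF that] by (auto intro: C_k_mult)
  qed
qed

lemma C_k_exp:
  assumes "C_k n v"
  shows "C_k n (\<lambda>x. exp (v x))"
  by (rule C_k_compose[of "{exp}"]) (use assms in \<open>auto intro: DERIV_exp\<close>)

text \<open>The polynomial factor makes this a family closed under differentiation; for
  \<open>p = 1\<close> it is the classical flat function exp(-1/t).\<close>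

definition exp_inv :: "real poly \<Rightarrow> real \<Rightarrow> real" where
  "exp_inv p t = (if t > 0 then poly p (1 / t) * exp (- (1 / t)) else 0)"

text \<open>Only the right limit has content: substituting 1/t turns it into the decay of p(t)
  exp(-t) at infinity.\<close>

lemma exp_inv_tendsto_0: "(exp_inv p \<longlongrightarrow> 0) (at 0)"
proof (rule filterlim_split_at_real)
  show "(exp_inv p \<longlongrightarrow> 0) (at_left 0)"
    by (rule tendsto_eventually) (auto simp: exp_inv_def eventually_at_filter)
  have "((\<lambda>t. poly p t * exp (- t)) \<longlongrightarrow> (0::real)) at_top"
  proof -
    have "((\<lambda>t. \<Sum>i\<le>degree p. coeff p i * (t ^ i / exp t)) \<longlongrightarrow> (\<Sum>i\<le>degree p. coeff p i * 0)) at_top"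
      by (intro tendsto_intros tendsto_power_div_exp_0)
    then show ?thesis
      by (simp add: poly_altdef sum_distrib_right exp_minus divide_inverse mult.assoc)
  qed
  then have "((\<lambda>t. poly p (inverse t) * exp (- inverse t)) \<longlongrightarrow> (0::real)) (at_right 0)"
    by (rule filterlim_compose[OF _ filterlim_inverse_at_top_right])
  then show "(exp_inv p \<longlongrightarrow> 0) (at_right 0)"
    by (rule Lim_transform_eventually)
      (auto simp: exp_inv_def eventually_at_filter inverse_eq_divide)
qed

text \<open>With s = 1/t one has d/dt = -s^2 d/ds, which sends p(s) exp(-s) to s^2 (p - p')(s)
  exp(-s); \<open>[:0, 0, 1:]\<close> is the polynomial s^2.\<close>

lemma exp_inv_has_derivative:
  "(exp_inv p has_real_derivative exp_inv ([:0, 0, 1:] * (p - pderiv p)) t) (at t)"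
proof -
  consider "t < 0" | "t = 0" | "t > 0" by linarith
  then show ?thesis
  proof cases
    case 1
    have "((\<lambda>_. 0) has_real_derivative 0) (at t)" by simp
    then have "(exp_inv p has_real_derivative 0) (at t)"
      by (rule has_field_derivative_transform_within_open[of _ _ _ "{..<0}"])
         (use 1 in \<open>auto simp: exp_inv_def\<close>)
    then show ?thesis using 1 by (simp add: exp_inv_def)
  next
    case 2
    \<comment> \<open>Dividing by h multiplies the polynomial by s = 1/h, so the difference quotient
      at 0 is again a member of the family and tends to 0.\<close>
    have "exp_inv p h / h = exp_inv (pCons 0 p) h" if "h \<noteq> 0" for h
      using that by (auto simp: exp_inv_def)
    then have "((\<lambda>h. exp_inv p h / h) \<longlongrightarrow> 0) (at 0)"
      by (intro Lim_transform_eventually[OF exp_inv_tendsto_0[of "pCons 0 p"]])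
         (auto simp: eventually_at_filter)
    then show ?thesis using 2
      by (simp add: has_field_derivative_iff exp_inv_def)
  next
    case 3
    have "((\<lambda>t. poly p (1 / t) * exp (- (1 / t))) has_real_derivative
       exp_inv ([:0, 0, 1:] * (p - pderiv p)) t) (at t)"
      using 3
      by (auto intro!: derivative_eq_intros simp: exp_inv_def algebra_simps power2_eq_square divide_simps)
    then show ?thesis
      by (rule has_field_derivative_transform_within_open[of _ _ _ "{0<..}"])
         (use 3 in \<open>auto simp: exp_inv_def\<close>)
  qed
qed

lemma C_k_exp_inv:
  assumes "C_k n v"
  shows "C_k n (\<lambda>x. exp_inv p (v x))"
  by (rule C_k_compose[of "range exp_inv"]) (use assms exp_inv_has_derivative in blast)+

lemma C_k_diff: "C_k n v \<Longrightarrow> C_k n w \<Longrightarrow> C_k n (\<lambda>x. v x - w x)"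
  using C_k_add[of n v "\<lambda>x. - 1 * w x"] C_k_mult[OF C_k_const[of n "-1"], of w] by simp

text \<open>Each factor is a translated or reflected exp(-1/t), flat at a face of the box, so the
  product is smooth on the whole space and positive exactly inside the open box.\<close>

definition box_bump :: "'a::euclidean_space \<Rightarrow> 'a \<Rightarrow> 'a \<Rightarrow> real" where
  "box_bump a b x =
     (\<Prod>i\<in>Basis. exp_inv 1 (x \<bullet> i - a \<bullet> i) * exp_inv 1 (b \<bullet> i - x \<bullet> i))"

lemma box_bump_smooth: "C_k n (box_bump a b)"
proof -
  have "C_k n (\<lambda>x. x \<bullet> i - a \<bullet> i)" "C_k n (\<lambda>x. b \<bullet> i - x \<bullet> i)" for i
    using C_k_affine[of n "- (a \<bullet> i)" i] C_k_affine[of n "b \<bullet> i" "- i"] by auto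
  then show ?thesis
    unfolding box_bump_def[abs_def]
    by (intro C_k_prod C_k_mult C_k_exp_inv) auto
qed

lemma box_bump_pos: "x \<in> box a b \<Longrightarrow> box_bump a b x > 0"
  unfolding box_bump_def by (rule prod_pos) (auto simp: box_def exp_inv_def)

lemma box_bump_eq_0: "x \<notin> box a b \<Longrightarrow> box_bump a b x = 0"
  unfolding box_bump_def box_def exp_inv_def by auto

lemma box_bump_nonneg: "box_bump a b x \<ge> 0"
  by (metis box_bump_eq_0 box_bump_pos less_eq_real_def)

text \<open>These test functions increase to the indicator function of the box.\<close>

definition box_approx :: "'a::euclidean_space \<Rightarrow> 'a \<Rightarrow> nat \<Rightarrow> 'a \<Rightarrow> real" where
  "box_approx a b n x = 1 - exp (- (real n * box_bump a b x))"

lemma box_approx_test_function: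
  assumes "cbox a b \<subseteq> U"
  shows "box_approx a b n \<in> test_functions U"
proof -
  have "C_k m (box_approx a b n)" for m
    using C_k_mult[OF C_k_const[of m "- real n"] box_bump_smooth[of m a b]]
    unfolding box_approx_def[abs_def] by (intro C_k_diff C_k_const C_k_exp) simp
  moreover have "closure {x. box_approx a b n x \<noteq> 0} \<subseteq> cbox a b"
    by (rule closure_minimal)
       (use box_bump_eq_0[of _ a b] box_subset_cbox[of a b] in \<open>auto simp: box_approx_def\<close>)
  ultimately show ?thesis
    using assms unfolding test_functions_def
    by (auto simp: compact_eq_bounded_closed intro: bounded_subset[OF bounded_cbox])
qed

lemma box_approx_tendsto: "(\<lambda>n. box_approx a b n x) \<longlonglongrightarrow> indicator (box a b) x"
proof (cases "x \<in> box a b")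
  case True
  then have "(\<lambda>n. 1 - exp (- (real n * box_bump a b x))) \<longlonglongrightarrow> 1 - 0"
    using box_bump_pos[OF True]
    by (intro tendsto_intros filterlim_compose[OF exp_at_bot])
       (auto simp: filterlim_uminus_at_bot intro!: filterlim_at_top_mult_tendsto_pos[OF tendsto_const] filterlim_real_sequentially)
  then show ?thesis using True by (simp add: box_approx_def)
qed (simp add: box_approx_def box_bump_eq_0)

lemma box_approx_bounds: "\<bar>box_approx a b n x\<bar> \<le> 1"
  using box_bump_nonneg[of a b x] by (simp add: box_approx_def abs_le_iff)

section \<open>The fundamental lemma of the calculus of variations\<close>

text \<open>Boxes are an intersection-stable generator of the Borel sets, and the sets over which
  \<open>F\<close> integrates to 0 form a Dynkin system; the vanishing total integral serves the
  complement step. A density whose integral vanishes over every Borel set is 0 almost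
  everywhere.\<close>

lemma AE_eq_0_if_box_integrals_0:
  fixes F :: "'a::euclidean_space \<Rightarrow> real"
  assumes F: "integrable lborel F" "(LINT x|lborel. F x) = 0"
    and box: "\<And>a b. (LINT x:box a b|lborel. F x) = 0"
  shows "AE x in lborel. F x = 0"
proof (rule density_unique_real)
  have int: "set_integrable lborel A F" if "A \<in> sets borel" for A
    using F(1) that unfolding set_integrable_def by (intro integrable_mult_indicator) auto
  fix A :: "'a set" assume "A \<in> sets lborel"
  then have "A \<in> sets borel" by simp
  then have A: "A \<in> sigma_sets UNIV (range (\<lambda>(a, b). box a b))"
    unfolding borel_eq_box by simp
  have "Int_stable (range (\<lambda>(a, b). box a b :: 'a set))"
    by (auto simp: Int_stable_def box_Int_box)
  moreover have "range (\<lambda>(a, b). box a b :: 'a set) \<subseteq> Pow UNIV"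
    by auto
  ultimately have "(LINT x:A|lborel. F x) = 0"
    using A
  proof (induction rule: sigma_sets_induct_disjoint)
    case (basic A)
    then show ?case using box by auto
  next
    case empty
    show ?case by (simp add: set_lebesgue_integral_def)
  next
    case (compl A)
    then have A: "A \<in> sets borel" by (simp add: borel_eq_box)
    have "(LINT x:A \<union> (UNIV - A)|lborel. F x)
        = (LINT x:A|lborel. F x) + (LINT x:UNIV - A|lborel. F x)"
      using A by (intro set_integral_Un int) auto
    then show ?case
      using F(2) compl by (simp add: set_lebesgue_integral_def)
  next
    case (union B)
    then have B: "B i \<in> sets borel" for i by (auto simp: borel_eq_box)
    have "(LINT x:(\<Union>i. B i)|lborel. F x) = (\<Sum>i. LINT x:B i|lborel. F x)"
      using union(1) B
      by (intro lebesgue_integral_countable_add int) (auto simp: disjoint_family_on_def)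
    then show ?case using union by simp
  qed
  then show "(LINT x:A|lborel. F x) = (LINT x:A|lborel. 0)"
    by (simp add: set_lebesgue_integral_def)
qed (use F in auto)

lemma lebesgue_on_integral_eq:
  fixes f :: "'a::euclidean_space \<Rightarrow> real"
  assumes "S \<in> sets lebesgue" "\<And>x. x \<notin> S \<Longrightarrow> f x = 0"
  shows "(\<integral>x. f x \<partial>lebesgue_on S) = (\<integral>x. f x \<partial>lebesgue)"
proof -
  have "(\<lambda>x. indicator S x *\<^sub>R f x) = f"
    using assms(2) by (fastforce simp: indicator_def)
  then show ?thesis
    using integral_restrict_space[of S lebesgue f] assms(1) by (simp del: real_scaleR_def)
qed

text \<open>Dominated convergence along \<open>box_approx\<close> replaces test functions by
  indicators of boxes with closure in \<open>U\<close>. The box criterion then applies locally, and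
  countably many closed boxes exhaust \<open>U\<close>.\<close>

lemma AE_eq_0_if_test_integrals_0:
  fixes F :: "'a::euclidean_space \<Rightarrow> real"
  assumes U: "open U"
    and F: "integrable (lebesgue_on U) F"
    and test: "\<And>\<phi>. \<phi> \<in> test_functions U \<Longrightarrow> (\<integral>x. F x * \<phi> x \<partial>lebesgue_on U) = 0"
  shows "AE x in lebesgue_on U. F x = 0"
proof -
  have [measurable]: "U \<in> sets borel" using U by auto
  \<comment> \<open>Extending by 0 and passing to a Borel representative \<open>G\<close> moves the
    problem from \<open>lebesgue_on U\<close> to \<open>lborel\<close>, where the box criterion is
    stated.\<close>
  define F0 where "F0 x = indicator U x * F x" for x
  have F0: "integrable lebesgue F0"
    using F by (simp add: integrable_restrict_space F0_def[abs_def])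
  then obtain G where G[measurable]: "G \<in> borel_measurable lborel" and FG: "AE x in lborel. F0 x = G x"
    using completion_ex_borel_measurable_real[of F0 lborel] by auto
  have "integrable lebesgue G"
    by (rule integrable_cong_AE_imp[OF F0])
       (use FG G in \<open>auto intro: AE_completion measurable_completion\<close>)
  then have intG: "integrable lborel G"
    by (simp add: integrable_completion)
  have testG: "(\<integral>x. \<phi> x * G x \<partial>lborel) = 0" if "\<phi> \<in> test_functions U" for \<phi>
  proof -
    have "C_k 0 \<phi>" using that by (auto simp: test_functions_def)
    then have [measurable]: "\<phi> \<in> borel_measurable borel"
      by (simp add: borel_measurable_continuous_onI)
    have "(\<integral>x. \<phi> x * G x \<partial>lborel) = (\<integral>x. \<phi> x * G x \<partial>lebesgue)"
      by (rule integral_completion[symmetric]) simp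
    also have "\<dots> = (\<integral>x. F0 x * \<phi> x \<partial>lebesgue)"
    proof (rule integral_cong_AE)
      show "AE x in lebesgue. \<phi> x * G x = F0 x * \<phi> x"
        by (rule AE_completion) (use FG in eventually_elim, simp)
      show "(\<lambda>x. \<phi> x * G x) \<in> borel_measurable lebesgue"
        by (intro measurable_completion) simp
      show "(\<lambda>x. F0 x * \<phi> x) \<in> borel_measurable lebesgue"
        using F0 by (intro borel_measurable_times) (auto intro: measurable_completion)
    qed
    also have "\<dots> = (\<integral>x. F x * \<phi> x \<partial>lebesgue_on U)"
      by (simp add: integral_restrict_space F0_def mult.assoc)
    finally show ?thesis using test[OF that] by simp
  qed
  have boxG: "(LINT x:box a b|lborel. G x) = 0" if "cbox a b \<subseteq> U" for a b
  proof -
    have "(\<lambda>n. \<integral>x. box_approx a b n x * G x \<partial>lborel) \<longlonglongrightarrow> (\<integral>x. indicator (box a b) x * G x \<partial>lborel)"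
    proof (rule integral_dominated_convergence[where w = "\<lambda>x. \<bar>G x\<bar>"])
      fix n
      have "C_k 0 (box_approx a b n)"
        using box_approx_test_function[OF that, of n] by (auto simp: test_functions_def)
      then have [measurable]: "box_approx a b n \<in> borel_measurable borel"
        by (simp add: borel_measurable_continuous_onI)
      show "(\<lambda>x. box_approx a b n x * G x) \<in> borel_measurable lborel" by simp
      show "AE x in lborel. norm (box_approx a b n x * G x) \<le> \<bar>G x\<bar>"
        by (intro AE_I2)
           (simp add: abs_mult mult_left_le_one_le box_approx_bounds)
    qed (use intG in \<open>auto intro!: tendsto_mult box_approx_tendsto\<close>)
    then have "(\<lambda>n. 0 :: real) \<longlonglongrightarrow> (\<integral>x. indicator (box a b) x * G x \<partial>lborel)"
      using testG[OF box_approx_test_function[OF that]] by simp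
    then show ?thesis
      by (simp add: LIMSEQ_const_iff set_lebesgue_integral_def)
  qed
  \<comment> \<open>\<open>G\<close> is cut off to a box inside \<open>U\<close>, so that the
    integral over an arbitrary box becomes one over the intersection, which is again a box with
    closure in \<open>U\<close> or empty.\<close>
  have AE_cbox: "AE x in lborel. x \<in> cbox c d \<longrightarrow> G x = 0" if cd: "cbox c d \<subseteq> U" for c d
  proof -
    have "AE x in lborel. indicator (box c d) x * G x = 0"
    proof (rule AE_eq_0_if_box_integrals_0)
      show "integrable lborel (\<lambda>x. indicator (box c d) x * G x)"
        using integrable_mult_indicator[OF _ intG, of "box c d"] by simp
      show "(\<integral>x. indicator (box c d) x * G x \<partial>lborel) = 0"
        using boxG[OF cd] by (simp add: set_lebesgue_integral_def)
      fix a b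
      obtain p q where pq: "box a b \<inter> box c d = box p q"
        by (auto simp: box_Int_box)
      have "(LINT x:box a b|lborel. indicator (box c d) x * G x) = (LINT x:box p q|lborel. G x)"
        unfolding set_lebesgue_integral_def pq[symmetric]
        by (rule Bochner_Integration.integral_cong) (auto simp: indicator_def)
      also have "\<dots> = 0"
      \<comment> \<open>The case split matters because \<open>cbox p q\<close> is the closure of
        \<open>box p q\<close> only if the open box is nonempty.\<close>
      proof (cases "box p q = {}")
        case False
        then have "cbox p q = closure (box p q)" by (simp add: closure_box)
        also have "\<dots> \<subseteq> cbox c d"
          using pq box_subset_cbox[of c d] by (intro closure_minimal) auto
        finally show ?thesis using cd boxG by blast
      qed (simp add: set_lebesgue_integral_def)
      finally show "(LINT x:box a b|lborel. indicator (box c d) x * G x) = 0" .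
    qed
    moreover have "AE x in lborel. x \<notin> cbox c d - box c d"
      using negligible_frontier_interval[of c d]
      by (intro AE_not_in) (auto simp: negligible_iff_null_sets null_sets_completion_iff)
    ultimately show ?thesis by eventually_elim (auto simp: indicator_def)
  qed
  obtain \<D> where \<D>: "countable \<D>" "\<D> \<subseteq> Pow U" "\<And>X. X \<in> \<D> \<Longrightarrow> \<exists>a b. X = cbox a b" "\<Union>\<D> = U"
    using open_countable_Union_open_cbox[OF U] by metis
  have "AE x in lborel. \<forall>X\<in>\<D>. x \<in> X \<longrightarrow> G x = 0"
  proof (rule AE_ball_countable'[OF _ \<D>(1)])
    fix X assume "X \<in> \<D>"
    with \<D>(2,3) obtain c d where "X = cbox c d" "cbox c d \<subseteq> U" by blast
    then show "AE x in lborel. x \<in> X \<longrightarrow> G x = 0" using AE_cbox by simp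
  qed
  with FG have "AE x in lborel. x \<in> U \<longrightarrow> F x = 0"
  proof eventually_elim
    case (elim x)
    show ?case
    proof
      assume "x \<in> U"
      with \<D>(4) obtain X where "X \<in> \<D>" "x \<in> X" by blast
      with elim \<open>x \<in> U\<close> show "F x = 0" by (simp add: F0_def)
    qed
  qed
  then show ?thesis
    by (subst AE_restrict_space_iff) (auto intro: AE_completion)
qed

section \<open>Vanishing integrals of gradients with compact support\<close>

lemma integrable_compact_support:
  fixes f :: "'a::euclidean_space \<Rightarrow> real"
  assumes "continuous_on UNIV f" "compact K" "\<And>x. x \<notin> K \<Longrightarrow> f x = 0"
  shows "integrable lborel f"
proof -
  have "(\<lambda>x. indicator K x *\<^sub>R f x) = f"
    using assms(3) by (fastforce simp: indicator_def)
  then show ?thesis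
    using borel_integrable_compact[OF assms(2) continuous_on_subset[OF assms(1)]] by simp
qed

lemma GDERIV_along:
  assumes "GDERIV f (x + t *\<^sub>R b) :> g"
  shows "((\<lambda>t. f (x + t *\<^sub>R b)) has_real_derivative g \<bullet> b) (at t)"
proof -
  have "((\<lambda>t. x + t *\<^sub>R b) has_derivative (\<lambda>h. h *\<^sub>R b)) (at t)"
    by (auto intro!: derivative_eq_intros)
  from has_derivative_compose[OF this assms[unfolded gderiv_def]] show ?thesis
    by (simp add: has_field_derivative_def inner_commute mult_commute_abs)
qed

lemma gradient_eq_0_off_support:
  assumes "GDERIV f x :> g" "x \<notin> closure {x. f x \<noteq> 0}"
  shows "g = 0"
proof -
  have "((\<lambda>_. 0) has_derivative (\<lambda>h. h \<bullet> g)) (at x)"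
    by (rule has_derivative_transform_within_open[OF assms(1)[unfolded gderiv_def], of "- closure {x. f x \<noteq> 0}"])
       (use assms(2) closure_subset[of "{x. f x \<noteq> 0}"] in auto)
  then have "(\<lambda>h. h \<bullet> g) = (\<lambda>h. 0)"
    using has_derivative_unique has_derivative_const by blast
  then show ?thesis by (metis inner_eq_zero_iff)
qed

text \<open>By translation invariance every difference quotient of \<open>\<phi>\<close> has integral \<open>0\<close>.\<close>

lemma integral_gradient_eq_0:
  fixes \<phi> :: "'a::euclidean_space \<Rightarrow> real"
  assumes grad: "\<And>x. GDERIV \<phi> x :> \<gamma> x"
    and cont: "continuous_on UNIV (\<lambda>x. \<gamma> x \<bullet> b)"
    and supp: "compact (closure {x. \<phi> x \<noteq> 0})"
  shows "(\<integral>x. \<gamma> x \<bullet> b \<partial>lborel) = 0"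
proof -
  define K where "K = closure {x. \<phi> x \<noteq> 0}"
  have compK: "compact K" using supp by (simp only: K_def)
  have \<phi>0: "\<phi> x = 0" if "x \<notin> K" for x
    using that closure_subset[of "{x. \<phi> x \<noteq> 0}"] by (auto simp: K_def)
  have \<gamma>0: "\<gamma> x = 0" if "x \<notin> K" for x
    using gradient_eq_0_off_support[OF grad] that by (auto simp: K_def)
  have cont\<phi>: "continuous_on UNIV \<phi>"
    using grad unfolding gderiv_def
    by (intro continuous_at_imp_continuous_on) (blast intro: has_derivative_continuous)
  have int\<phi>: "integrable lborel \<phi>"
    using cont\<phi> compK \<phi>0 by (rule integrable_compact_support)
  have [measurable]: "\<phi> \<in> borel_measurable borel" "(\<lambda>x. \<gamma> x \<bullet> b) \<in> borel_measurable borel"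
    using cont cont\<phi> by (auto intro: borel_measurable_continuous_onI)
  obtain R where R: "K \<subseteq> cball 0 R"
    using compact_imp_bounded[OF compK] by (auto simp: bounded_iff subset_iff)
  have "bounded ((\<lambda>x. \<gamma> x \<bullet> b) ` K)"
    using compK cont
    by (intro compact_imp_bounded compact_continuous_image) (auto intro: continuous_on_subset)
  then obtain B where B: "B > 0" "\<And>x. x \<in> K \<Longrightarrow> \<bar>\<gamma> x \<bullet> b\<bar> \<le> B"
    by (auto simp: bounded_pos)
  then have B': "\<bar>\<gamma> x \<bullet> b\<bar> \<le> B" for x
    using \<gamma>0[of x] by (cases "x \<in> K") auto
  define t where "t n = 1 / real (Suc n)" for n
  have t: "0 < t n" "t n \<le> 1" for n by (auto simp: t_def)
  define q where "q n x = (\<phi> (x + t n *\<^sub>R b) - \<phi> x) / t n" for n x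
  have q_int: "(\<integral>x. q n x \<partial>lborel) = 0" for n
  proof -
    have "integrable (distr lborel borel ((+) (t n *\<^sub>R b))) \<phi>"
      using int\<phi> by (simp add: lborel_distr_plus)
    then have 1: "integrable lborel (\<lambda>x. \<phi> (t n *\<^sub>R b + x))"
      by (subst (asm) integrable_distr_eq) auto
    have "(\<integral>x. \<phi> (t n *\<^sub>R b + x) \<partial>lborel) = (\<integral>x. \<phi> x \<partial>distr lborel borel ((+) (t n *\<^sub>R b)))"
      by (rule integral_distr[symmetric]) auto
    then have "(\<integral>x. \<phi> (t n *\<^sub>R b + x) \<partial>lborel) = (\<integral>x. \<phi> x \<partial>lborel)"
      by (simp add: lborel_distr_plus)
    with 1 int\<phi> show ?thesis
      by (simp add: q_def add.commute)
  qed
  have q_lim: "(\<lambda>n. q n x) \<longlonglongrightarrow> \<gamma> x \<bullet> b" for x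
  proof -
    have "((\<lambda>t. \<phi> (x + t *\<^sub>R b)) has_real_derivative \<gamma> x \<bullet> b) (at 0)"
      by (rule GDERIV_along) (simp add: grad)
    then have "((\<lambda>t. (\<phi> (x + t *\<^sub>R b) - \<phi> x) / t) \<longlongrightarrow> \<gamma> x \<bullet> b) (at 0)"
      by (simp add: has_field_derivative_iff)
    moreover have "filterlim t (at 0) sequentially"
      using LIMSEQ_Suc[OF lim_1_over_n] t
      by (auto simp: filterlim_at t_def[abs_def] intro!: always_eventually)
    ultimately show ?thesis
      unfolding q_def by (rule filterlim_compose)
  qed
  \<comment> \<open>The mean value theorem bounds the quotient by \<open>B\<close>. As
    \<open>t n\<close> is at most 1, the quotient vanishes outside the ball around the support
    enlarged by \<open>norm b\<close>. This dominating function does not depend on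
    \<open>n\<close>.\<close>
  have q_bound: "\<bar>q n x\<bar> \<le> B * indicator (cball 0 (R + norm b)) x" for n x
  proof (cases "x \<in> cball 0 (R + norm b)")
    case True
    obtain s where "\<phi> (x + t n *\<^sub>R b) - \<phi> (x + 0 *\<^sub>R b) = (t n - 0) * (\<gamma> (x + s *\<^sub>R b) \<bullet> b)"
      using MVT2[of 0 "t n" "\<lambda>t. \<phi> (x + t *\<^sub>R b)" "\<lambda>s. \<gamma> (x + s *\<^sub>R b) \<bullet> b"] t GDERIV_along[OF grad]
      by blast
    then have "q n x = \<gamma> (x + s *\<^sub>R b) \<bullet> b"
      using t[of n] by (simp add: q_def)
    then show ?thesis using True B' by simp
  next
    case False
    then have "norm x > R + norm b" by simp
    moreover have "norm (t n *\<^sub>R b) \<le> norm b"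
      using t[of n] by (simp add: mult_left_le_one_le)
    moreover have "norm x \<le> norm (x + t n *\<^sub>R b) + norm (t n *\<^sub>R b)"
      by (metis add_diff_cancel_right' norm_triangle_ineq4)
    ultimately have "norm x > R" "norm (x + t n *\<^sub>R b) > R"
      using norm_ge_zero[of b] by linarith+
    then have "x \<notin> K" "x + t n *\<^sub>R b \<notin> K"
      using R by (auto simp: subset_iff)
    then show ?thesis using False by (simp add: q_def \<phi>0)
  qed
  have "(\<lambda>n. \<integral>x. q n x \<partial>lborel) \<longlonglongrightarrow> (\<integral>x. \<gamma> x \<bullet> b \<partial>lborel)"
  proof (rule integral_dominated_convergence[where w = "\<lambda>x. B * indicator (cball 0 (R + norm b)) x"])
    show "integrable lborel (\<lambda>x. B * indicator (cball 0 (R + norm b)) x :: real)"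
      by (intro integrable_mult_right integrable_real_indicator emeasure_lborel_cball_finite) auto
    show "q n \<in> borel_measurable lborel" for n
      unfolding q_def[abs_def] by simp
  qed (use q_lim q_bound in auto)
  then show ?thesis by (simp add: q_int LIMSEQ_const_iff)
qed

section \<open>Weak gradients of affine functions\<close>

lemma integrable_lebesgue_on_subset:
  fixes f :: "'a::euclidean_space \<Rightarrow> real"
  assumes "integrable (lebesgue_on D) f" "U \<subseteq> D" "U \<in> sets lebesgue" "D \<in> sets lebesgue"
  shows "integrable (lebesgue_on U) f"
proof -
  have "set_integrable lebesgue D f"
    using assms by (simp add: integrable_restrict_space set_integrable_def)
  then have "set_integrable lebesgue U f"
    using assms(3,2) by (rule set_integrable_subset)
  then show ?thesis
    using assms by (simp add: integrable_restrict_space set_integrable_def)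
qed

text \<open>Integration by parts: the product of the affine function and \<open>\<phi>\<close> has
  compact support, so each component of its gradient integrates to 0, and the product rule splits
  that integral.\<close>

lemma integral_affine_gradient:
  fixes \<phi> :: "'a::euclidean_space \<Rightarrow> real"
  assumes grad: "\<And>x. GDERIV \<phi> x :> \<gamma> x"
    and cont: "continuous_on UNIV (\<lambda>x. \<gamma> x \<bullet> b)"
    and supp: "compact (closure {x. \<phi> x \<noteq> 0})"
  shows "(\<integral>x. (c + g \<bullet> x) * (\<gamma> x \<bullet> b) \<partial>lborel) = - (\<integral>x. (g \<bullet> b) * \<phi> x \<partial>lborel)"
proof -
  define K where "K = closure {x. \<phi> x \<noteq> 0}"
  have compK: "compact K" using supp by (simp only: K_def)
  have \<phi>0: "\<phi> x = 0" if "x \<notin> K" for x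
    using that closure_subset[of "{x. \<phi> x \<noteq> 0}"] by (auto simp: K_def)
  have \<gamma>0: "\<gamma> x = 0" if "x \<notin> K" for x
    using gradient_eq_0_off_support[OF grad] that by (auto simp: K_def)
  have cont\<phi>: "continuous_on UNIV \<phi>"
    using grad unfolding gderiv_def
    by (intro continuous_at_imp_continuous_on) (blast intro: has_derivative_continuous)
  have cont_affine: "continuous_on UNIV (\<lambda>x. c + g \<bullet> x)"
    by (intro continuous_intros)
  have int1: "integrable lborel (\<lambda>x. (c + g \<bullet> x) * (\<gamma> x \<bullet> b))"
    by (rule integrable_compact_support[OF continuous_on_mult[OF cont_affine cont] compK])
       (simp add: \<gamma>0)
  have int2: "integrable lborel (\<lambda>x. (g \<bullet> b) * \<phi> x)"
    by (rule integrable_compact_support[OF continuous_on_mult_left[OF cont\<phi>] compK])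
       (simp add: \<phi>0)
  have "closure {x. (c + g \<bullet> x) * \<phi> x \<noteq> 0} \<subseteq> K"
    unfolding K_def by (rule closure_mono) auto
  then have comp: "compact (closure {x. (c + g \<bullet> x) * \<phi> x \<noteq> 0})"
    unfolding compact_eq_bounded_closed
    using bounded_subset[OF compact_imp_bounded[OF compK]] by blast
  have "GDERIV (\<lambda>x. c + g \<bullet> x) x :> g" for x
    unfolding gderiv_def by (auto intro!: derivative_eq_intros simp: inner_commute)
  then have "GDERIV (\<lambda>x. (c + g \<bullet> x) * \<phi> x) x :> (c + g \<bullet> x) *\<^sub>R \<gamma> x + \<phi> x *\<^sub>R g" for x
    by (intro GDERIV_mult grad)
  then have "(\<integral>x. ((c + g \<bullet> x) *\<^sub>R \<gamma> x + \<phi> x *\<^sub>R g) \<bullet> b \<partial>lborel) = 0"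
  proof (rule integral_gradient_eq_0[OF _ _ comp])
    show "continuous_on UNIV (\<lambda>x. ((c + g \<bullet> x) *\<^sub>R \<gamma> x + \<phi> x *\<^sub>R g) \<bullet> b)"
      using continuous_on_add[OF continuous_on_mult[OF cont_affine cont]
          continuous_on_mult_right[OF cont\<phi>, of "g \<bullet> b"]]
      by (simp add: inner_add_left)
  qed
  then have "(\<integral>x. (c + g \<bullet> x) * (\<gamma> x \<bullet> b) + (g \<bullet> b) * \<phi> x \<partial>lborel) = 0"
    by (simp add: inner_add_left mult.commute)
  then show ?thesis
    using Bochner_Integration.integral_add[OF int1 int2] by simp
qed

text \<open>Testing with functions supported in \<open>U\<close> only sees \<open>v\<close> where it
  is affine. There the weak gradient and the constant \<open>g\<close> have the same integrals
  against every test function, so the fundamental lemma applies to each component of their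
  difference.\<close>

lemma has_weak_gradient_affine:
  fixes D :: "'a::euclidean_space set"
  assumes D: "open D" and G: "has_weak_gradient D v G"
    and U: "open U" "U \<subseteq> D" "bounded U"
    and v: "\<And>x. x \<in> U \<Longrightarrow> v x = c + g \<bullet> x"
  shows "AE x in lebesgue_on U. G x = g"
proof -
  have sets: "U \<in> sets lebesgue" "D \<in> sets lebesgue" using D U(1) by auto
  have G2: "integrable (lebesgue_on D) (\<lambda>x. (norm (G x))\<^sup>2)" "G \<in> borel_measurable (lebesgue_on D)"
    using G by (auto simp: has_weak_gradient_def L2_def)
  interpret finite_measure "lebesgue_on U"
    using sets U(3) by (intro finite_measure_lebesgue_on bounded_set_imp_lmeasurable)
  \<comment> \<open>On a set of finite measure, square integrability of \<open>G\<close> gives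
    integrability of its components, since |t| <= 1 + t^2.\<close>
  have dom: "integrable (lebesgue_on U) (\<lambda>x. 1 + (norm (G x))\<^sup>2)"
    using integrable_lebesgue_on_subset[OF G2(1) U(2) sets]
    by (intro Bochner_Integration.integrable_add) auto
  have measG: "G \<in> borel_measurable (lebesgue_on U)"
    using G2(2) U(2) by (rule measurable_restrict_mono)
  have intG: "integrable (lebesgue_on U) (\<lambda>x. G x \<bullet> b)" if "b \<in> Basis" for b
  proof (rule Bochner_Integration.integrable_bound[OF dom])
    have "\<bar>G x \<bullet> b\<bar> \<le> 1 + (norm (G x))\<^sup>2" for x
    proof -
      have "\<bar>G x \<bullet> b\<bar> \<le> norm (G x)" using that by (rule Basis_le_norm)
      also have "\<dots> \<le> 1 + (norm (G x))\<^sup>2"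
        using sum_squares_bound[of "norm (G x)" 1] norm_ge_zero[of "G x"]
        unfolding power_one mult_1_right by linarith
      finally show ?thesis .
    qed
    then show "AE x in lebesgue_on U. norm (G x \<bullet> b) \<le> norm (1 + (norm (G x))\<^sup>2)"
      by (auto intro!: AE_I2)
  qed (use measG in auto)
  have "AE x in lebesgue_on U. (G x - g) \<bullet> b = 0" if b: "b \<in> Basis" for b
  proof (rule AE_eq_0_if_test_integrals_0[OF U(1)])
    have const: "integrable (lebesgue_on U) (\<lambda>x. g \<bullet> b)"
      by simp
    show "integrable (lebesgue_on U) (\<lambda>x. (G x - g) \<bullet> b)"
      using intG[OF b] const by (simp add: inner_diff_left)
    fix \<phi> assume \<phi>: "\<phi> \<in> test_functions U"
    then have \<phi>D: "\<phi> \<in> test_functions D"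
      and supp: "compact (closure {x. \<phi> x \<noteq> 0})" "closure {x. \<phi> x \<noteq> 0} \<subseteq> U"
      and smooth: "C_k n \<phi>" for n
      using U(2) by (auto simp: test_functions_def)
    obtain \<gamma> where \<gamma>: "\<And>x. GDERIV \<phi> x :> \<gamma> x" "\<And>b. b \<in> Basis \<Longrightarrow> C_k 0 (\<lambda>x. \<gamma> x \<bullet> b)"
      using smooth[of "Suc 0"] by (elim C_k_SucE) blast
    have cont: "continuous_on UNIV (\<lambda>x. \<gamma> x \<bullet> b)" using \<gamma>(2)[OF b] by simp
    have \<phi>0: "\<phi> x = 0" and \<gamma>0: "\<gamma> x = 0" if "x \<notin> U" for x
      using that supp(2) closure_subset[of "{x. \<phi> x \<noteq> 0}"] gradient_eq_0_off_support[OF \<gamma>(1), of x]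
      by auto
    have [measurable]: "\<phi> \<in> borel_measurable borel" "(\<lambda>x. \<gamma> x \<bullet> b) \<in> borel_measurable borel"
      using cont smooth[of 0] by (auto intro: borel_measurable_continuous_onI)
    have "bounded (\<phi> ` closure {x. \<phi> x \<noteq> 0})"
      using smooth[of 0] supp(1)
      by (intro compact_imp_bounded compact_continuous_image) (auto intro: continuous_on_subset)
    then obtain B where "\<And>x. x \<in> closure {x. \<phi> x \<noteq> 0} \<Longrightarrow> \<bar>\<phi> x\<bar> \<le> B"
      by (auto simp: bounded_iff)
    \<comment> \<open>If the support is empty, the bound \<open>B\<close> may be negative; hence its
      absolute value.\<close>
    then have B: "\<bar>\<phi> x\<bar> \<le> \<bar>B\<bar>" for x
      using closure_subset[of "{x. \<phi> x \<noteq> 0}"] by (cases "\<phi> x = 0") force+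
    have measU: "\<phi> \<in> borel_measurable (lebesgue_on U)"
      by (intro measurable_restrict_space1 measurable_completion) simp
    have mult: "integrable (lebesgue_on U) (\<lambda>x. f x * \<phi> x)"
      if "integrable (lebesgue_on U) f" for f
    proof (rule Bochner_Integration.integrable_bound[OF integrable_mult_right[OF that, of "\<bar>B\<bar>"]])
      show "AE x in lebesgue_on U. norm (f x * \<phi> x) \<le> norm (\<bar>B\<bar> * f x)"
        using B by (simp add: abs_mult mult.commute[of "\<bar>B\<bar>"] mult_left_mono)
    qed (use that measU in auto)
    \<comment> \<open>The chain passes from \<open>U\<close> to \<open>D\<close> because
      \<open>\<phi>\<close> vanishes off \<open>U\<close>, uses the definition of the weak gradient
      on \<open>D\<close>, replaces \<open>v\<close> by its affine formula where
      \<open>\<gamma>\<close> is nonzero, and integrates by parts over the whole space.\<close>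
    have "(\<integral>x. (G x - g) \<bullet> b * \<phi> x \<partial>lebesgue_on U)
        = (\<integral>x. G x \<bullet> b * \<phi> x \<partial>lebesgue_on U) - (\<integral>x. g \<bullet> b * \<phi> x \<partial>lebesgue_on U)"
      using mult[OF intG[OF b]] mult[OF const] by (simp add: inner_diff_left left_diff_distrib)
    also have "(\<integral>x. G x \<bullet> b * \<phi> x \<partial>lebesgue_on U) = (\<integral>x. G x \<bullet> b * \<phi> x \<partial>lebesgue_on D)"
      using \<phi>0 U(2) sets by (subst (1 2) lebesgue_on_integral_eq) auto
    also have "\<dots> = - (\<integral>x. v x * (\<gamma> x \<bullet> b) \<partial>lebesgue_on D)"
      using G \<phi>D \<gamma>(1) b unfolding has_weak_gradient_def by force
    also have "(\<integral>x. v x * (\<gamma> x \<bullet> b) \<partial>lebesgue_on D) = (\<integral>x. v x * (\<gamma> x \<bullet> b) \<partial>lebesgue)"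
    proof (intro lebesgue_on_integral_eq sets)
      show "v x * (\<gamma> x \<bullet> b) = 0" if "x \<notin> D" for x
      proof -
        have "\<gamma> x = 0" using \<gamma>0 U(2) that by blast
        then show ?thesis by simp
      qed
    qed
    also have "\<dots> = (\<integral>x. (c + g \<bullet> x) * (\<gamma> x \<bullet> b) \<partial>lebesgue)"
    proof (rule Bochner_Integration.integral_cong)
      show "v x * (\<gamma> x \<bullet> b) = (c + g \<bullet> x) * (\<gamma> x \<bullet> b)" for x
        using v[of x] \<gamma>0[of x] by (cases "x \<in> U") auto
    qed simp
    also have "\<dots> = (\<integral>x. (c + g \<bullet> x) * (\<gamma> x \<bullet> b) \<partial>lborel)"
      by (intro integral_completion) simp
    also have "\<dots> = - (\<integral>x. (g \<bullet> b) * \<phi> x \<partial>lborel)"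
      by (rule integral_affine_gradient[OF \<gamma>(1) cont supp(1)])
    also have "(\<integral>x. (g \<bullet> b) * \<phi> x \<partial>lborel) = (\<integral>x. (g \<bullet> b) * \<phi> x \<partial>lebesgue)"
      by (intro integral_completion[symmetric]) simp
    also have "\<dots> = (\<integral>x. (g \<bullet> b) * \<phi> x \<partial>lebesgue_on U)"
      using \<phi>0 sets by (intro lebesgue_on_integral_eq[symmetric]) auto
    finally show "(\<integral>x. (G x - g) \<bullet> b * \<phi> x \<partial>lebesgue_on U) = 0" by simp
  qed
  then have "AE x in lebesgue_on U. \<forall>b\<in>Basis. (G x - g) \<bullet> b = 0"
    by (intro AE_finite_allI finite_Basis)
  then show ?thesis
  proof eventually_elim
    case (elim x)
    show ?case
      by (rule euclidean_eqI) (use elim in \<open>simp add: inner_diff_left\<close>)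
  qed
qed

text \<open>\<open>weak_gradient\<close> is selected by \<open>SOME\<close>; membership in
  \<open>H1\<close> guarantees that the selected function is a weak gradient.\<close>

lemma weak_gradient_affine:
  assumes "open D" "v \<in> H1 D" "open U" "U \<subseteq> D" "bounded U"
    and "\<And>x. x \<in> U \<Longrightarrow> v x = c + g \<bullet> x"
  shows "AE x in lebesgue_on U. weak_gradient D v x = g"
proof (rule has_weak_gradient_affine)
  show "has_weak_gradient D v (weak_gradient D v)"
    using assms(2) someI_ex[of "has_weak_gradient D v"]
    unfolding H1_def weak_gradient_def by blast
qed (use assms in auto)

section \<open>Interior nodes of simplicial meshes\<close>

lemma simplex_vertices:
  fixes K :: "'a::euclidean_space set"
  assumes "int DIM('a) simplex K"
  shows "finite (vertices K)" "card (vertices K) = DIM('a) + 1" "convex hull vertices K = K"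
proof -
  obtain C where C: "finite C" "\<not> affine_dependent C" "int (card C) = int DIM('a) + 1" "K = convex hull C"
    using assms unfolding simplex by auto
  then have "vertices K = C"
    unfolding vertices_def by (auto simp: extreme_point_of_convex_hull_affine_independent)
  with C show "finite (vertices K)" "card (vertices K) = DIM('a) + 1" "convex hull vertices K = K"
    by auto
qed

text \<open>The zero set {g . x = -c} is convex, also for g = 0, so with \<open>P\<close> it
  contains the hull.\<close>

lemma affine_eq_0_on_convex_hull:
  assumes "\<And>x. x \<in> convex hull P \<Longrightarrow> v x = c + g \<bullet> x"
    and "\<And>p. p \<in> P \<Longrightarrow> v p = 0" and "x \<in> convex hull P"
  shows "v x = 0"
proof -
  have "P \<subseteq> {x. g \<bullet> x = - c}"
  proof
    fix p assume "p \<in> P"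
    then show "p \<in> {x. g \<bullet> x = - c}"
      using assms(1)[of p] assms(2)[of p] hull_inc[of p P] by auto
  qed
  then have "convex hull P \<subseteq> {x. g \<bullet> x = - c}"
    by (rule hull_minimal) (rule convex_hyperplane)
  with assms show ?thesis by auto
qed

lemma sum_fun_apply: "(\<Sum>i\<in>I. f i) x = (\<Sum>i\<in>I. f i x :: 'b::comm_monoid_add)"
  by (induction I rule: infinite_finite_induct) auto

context
  fixes D :: "'a::euclidean_space set" and T
  assumes mesh: "simplicial_mesh D T"
begin

lemma mesh_finite: "finite T"
  using mesh by (auto simp: simplicial_mesh_def triangulation_def)

lemma mesh_Union: "\<Union>T = closure D"
  using mesh by (auto simp: simplicial_mesh_def)

lemma mesh_simplex: "K \<in> T \<Longrightarrow> int DIM('a) simplex K"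
  using mesh by (auto simp: simplicial_mesh_def)

lemma interior_nodes_finite: "finite (interior_nodes D T)"
  using mesh_finite mesh_simplex simplex_vertices(1) by (auto simp: interior_nodes_def)

lemma card_interior_nodes_le: "card (interior_nodes D T) \<le> card T * (DIM('a) + 1)"
proof -
  have "card (interior_nodes D T) \<le> card (\<Union>K\<in>T. vertices K)"
    using mesh_finite mesh_simplex simplex_vertices(1)
    by (intro card_mono) (auto simp: interior_nodes_def)
  also have "\<dots> \<le> (\<Sum>K\<in>T. card (vertices K))"
    using mesh_finite by (rule card_UN_le)
  also have "\<dots> = card T * (DIM('a) + 1)"
    by (simp add: simplex_vertices(2)[OF mesh_simplex])
  finally show ?thesis .
qed

text \<open>Every vertex of a cell is an interior node or lies outside \<open>D\<close>, so
  \<open>v\<close> vanishes at all vertices and hence on every cell. Assuming only piecewise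
  affinity lets the lemma apply directly to the difference of a function and its nodal
  interpolant.\<close>

lemma piecewise_affine_eq_0:
  assumes "\<And>K. K \<in> T \<Longrightarrow> \<exists>c g. \<forall>x\<in>K. v x = c + g \<bullet> x"
    and "\<And>x. x \<notin> D \<Longrightarrow> v x = 0" and "\<And>p. p \<in> interior_nodes D T \<Longrightarrow> v p = 0"
  shows "v x = 0"
proof (cases "x \<in> D")
  case True
  then obtain K where K: "K \<in> T" "x \<in> K"
    using mesh_Union closure_subset by blast
  obtain c g where "\<And>x. x \<in> K \<Longrightarrow> v x = c + g \<bullet> x"
    using assms(1)[OF K(1)] by blast
  moreover have "v p = 0" if "p \<in> vertices K" for p
    using assms(2,3) that K(1) by (cases "p \<in> D") (auto simp: interior_nodes_def)
  ultimately show ?thesis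
    using affine_eq_0_on_convex_hull[of "vertices K" v c g x] K
    by (simp add: simplex_vertices(3)[OF mesh_simplex])
qed (use assms in auto)

text \<open>The hat functions are a basis: a finite element function equals its nodal interpolant by
  \<open>piecewise_affine_eq_0\<close>, and evaluation at the nodes reads off the coefficients of a
  linear relation.\<close>

lemma fe_dim_eq_card_interior_nodes:
  assumes basis: "nodal_basis D T \<phi>"
  shows "fe_dim D T = card (interior_nodes D T)"
proof -
  interpret vs: vector_space "\<lambda>(c::real) (v::'a \<Rightarrow> real) x. c * v x"
    by unfold_locales (auto simp: fun_eq_iff algebra_simps)
  let ?N = "interior_nodes D T"
  have \<phi>: "\<phi> p \<in> S1 D T" "\<And>q. q \<in> ?N \<Longrightarrow> \<phi> p q = (if q = p then 1 else 0)" if "p \<in> ?N" for p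
    using basis that by (auto simp: nodal_basis_def)
  have "inj_on \<phi> ?N"
    by (rule inj_onI) (metis \<phi>(2) zero_neq_one)
  have "fe_dim D T = card (\<phi> ` ?N)"
    unfolding fe_dim_def
  proof (rule vs.dim_unique)
    show "\<phi> ` ?N \<subseteq> S1 D T" using \<phi> by auto
    show "S1 D T \<subseteq> vs.span (\<phi> ` ?N)"
    proof
      fix v assume v: "v \<in> S1 D T"
      define w where "w x = v x - (\<Sum>p\<in>?N. v p * \<phi> p x)" for x
      have w0: "w x = 0" for x
      proof (rule piecewise_affine_eq_0)
        fix K assume K: "K \<in> T"
        have "\<forall>p\<in>?N. \<exists>c g. \<forall>x\<in>K. \<phi> p x = c + g \<bullet> x"
          using \<phi>(1) K by (auto simp: S1_def)
        then obtain c g where cg: "\<And>p x. p \<in> ?N \<Longrightarrow> x \<in> K \<Longrightarrow> \<phi> p x = c p + g p \<bullet> x"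
          by metis
        obtain c0 g0 where cg0: "\<And>x. x \<in> K \<Longrightarrow> v x = c0 + g0 \<bullet> x"
          using v K by (auto simp: S1_def)
        have "w x = (c0 - (\<Sum>p\<in>?N. v p * c p)) + (g0 - (\<Sum>p\<in>?N. v p *\<^sub>R g p)) \<bullet> x" if "x \<in> K" for x
          using cg cg0 that
          by (simp add: w_def inner_diff_left inner_sum_left distrib_left sum.distrib)
        then show "\<exists>c g. \<forall>x\<in>K. w x = c + g \<bullet> x" by blast
      next
        show "w x = 0" if "x \<notin> D" for x
          using v \<phi>(1) that by (auto simp: w_def S1_def)
      next
        fix q assume q: "q \<in> ?N"
        have "(\<Sum>p\<in>?N. v p * \<phi> p q) = (\<Sum>p\<in>?N. if p = q then v q else 0)"
          using \<phi>(2) q by (intro sum.cong) auto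
        then show "w q = 0"
          using q interior_nodes_finite by (simp add: w_def)
      qed
      have "v = (\<Sum>p\<in>?N. (\<lambda>x. v p * \<phi> p x))"
      proof
        show "v x = (\<Sum>p\<in>?N. (\<lambda>x. v p * \<phi> p x)) x" for x
          using w0[of x] by (simp only: w_def sum_fun_apply right_minus_eq)
      qed
      also have "\<dots> \<in> vs.span (\<phi> ` ?N)"
        by (intro vs.span_sum vs.span_scale vs.span_base) auto
      finally show "v \<in> vs.span (\<phi> ` ?N)" .
    qed
    show "vs.independent (\<phi> ` ?N)"
    proof (rule vs.independent_if_scalars_zero)
      fix f b assume f: "(\<Sum>b\<in>\<phi> ` ?N. (\<lambda>x. f b * b x)) = 0" and "b \<in> \<phi> ` ?N"
      then obtain q where q: "q \<in> ?N" "b = \<phi> q" by auto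
      have "0 = (\<Sum>p\<in>?N. f (\<phi> p) * \<phi> p q)"
        using fun_cong[OF f, of q] by (simp add: sum.reindex \<open>inj_on \<phi> ?N\<close> sum_fun_apply)
      also have "\<dots> = (\<Sum>p\<in>?N. if p = q then f (\<phi> q) else 0)"
        using \<phi>(2) q by (intro sum.cong) auto
      finally show "f b = 0"
        using q interior_nodes_finite by simp
    qed (use interior_nodes_finite in auto)
  qed simp
  then show ?thesis
    using \<open>inj_on \<phi> ?N\<close> by (simp add: card_image)
qed

text \<open>The exceptional points lie on the frontiers of finitely many convex sets, which are
  negligible.\<close>

lemma AE_mesh_interior:
  assumes "D \<in> sets lebesgue"
  shows "AE x in lebesgue_on D. \<exists>K\<in>T. x \<in> interior K"
proof -
  have *: "AE x in lebesgue. \<forall>K\<in>T. x \<notin> frontier K"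
  proof (rule AE_finite_allI[OF mesh_finite])
    fix K assume "K \<in> T"
    then have "negligible (frontier K)"
      using mesh_simplex convex_simplex negligible_convex_frontier by blast
    then show "AE x in lebesgue. x \<notin> frontier K"
      by (intro AE_not_in) (simp add: negligible_iff_null_sets)
  qed
  have cell: "\<exists>K\<in>T. x \<in> interior K" if "x \<in> D" "\<forall>K\<in>T. x \<notin> frontier K" for x
  proof -
    from that(1) obtain K where "K \<in> T" "x \<in> K"
      using mesh_Union closure_subset by blast
    with that(2) show ?thesis
      using closure_subset[of K] by (auto simp: frontier_def)
  qed
  from * have "AE x in lebesgue. x \<in> D \<longrightarrow> (\<exists>K\<in>T. x \<in> interior K)"
    by eventually_elim (use cell in blast)
  then show ?thesis
    using assms by (simp add: AE_restrict_space_iff)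
qed

text \<open>In a triangulation the intersection of two cells is a face of both, and a proper face
  misses the interior.\<close>

lemma mesh_interiors_disjoint:
  assumes "K \<in> T" "L \<in> T" "x \<in> interior K" "x \<in> interior L"
  shows "K = L"
proof -
  have "A \<inter> B = A" if "A \<in> T" "B \<in> T" "x \<in> interior A" "x \<in> interior B" for A B
  proof (rule ccontr)
    assume "A \<inter> B \<noteq> A"
    moreover have "(A \<inter> B) face_of A"
      using mesh that by (auto simp: simplicial_mesh_def triangulation_def)
    ultimately have "(A \<inter> B) \<inter> interior A = {}"
      by (intro face_of_disjoint_interior)
    with that show False using interior_subset by blast
  qed
  from this[of K L] this[of L K] assms show ?thesis by blast
qed

end

section \<open>Growth of the number of interior nodes\<close>

lemma mesh_sequence_simplicial: "mesh_sequence D T \<Longrightarrow> simplicial_mesh D (T l)"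
  by (auto simp: mesh_sequence_def)

lemma card_mesh_le:
  fixes D :: "'a::euclidean_space set"
  assumes "mesh_sequence D T"
  shows "card (T l) \<le> card (T 0) * 2 ^ (DIM('a) * l)"
proof (induction l)
  case (Suc l)
  have ref: "uniform_refinement (T l) (T (Suc l))"
    using assms by (auto simp: mesh_sequence_def)
  have fin: "finite (T l)"
    using mesh_finite[OF mesh_sequence_simplicial[OF assms]] .
  have "T (Suc l) = (\<Union>K\<in>T l. {K' \<in> T (Suc l). K' \<subseteq> K})"
    using ref by (auto simp: uniform_refinement_def)
  then have "card (T (Suc l)) \<le> (\<Sum>K\<in>T l. card {K' \<in> T (Suc l). K' \<subseteq> K})"
    using card_UN_le[OF fin] by metis
  also have "\<dots> = card (T l) * 2 ^ DIM('a)"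
    using ref by (simp add: uniform_refinement_def)
  also have "\<dots> \<le> card (T 0) * 2 ^ (DIM('a) * l) * 2 ^ DIM('a)"
    using Suc.IH by simp
  finally show ?case by (simp add: power_add algebra_simps)
qed simp

text \<open>The corner simplex at a node \<open>p\<close> belongs to the refined mesh. It lies in
  the parent cell, where \<open>p\<close> is extreme, so \<open>p\<close> is extreme in the smaller
  simplex too.\<close>

lemma interior_nodes_refinement:
  fixes D :: "'a::euclidean_space set"
  assumes mesh: "simplicial_mesh D T" and ref: "uniform_refinement T T'"
  shows "interior_nodes D T \<subseteq> interior_nodes D T'"
proof
  fix p assume "p \<in> interior_nodes D T"
  then obtain K where K: "K \<in> T" "p \<in> vertices K" and p: "p \<in> D"
    by (auto simp: interior_nodes_def)
  define K' where "K' = convex hull (midpoint p ` vertices K)"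
  have "K' \<in> T'"
    using ref K by (auto simp: uniform_refinement_def K'_def)
  have vK: "vertices K \<subseteq> K"
    by (auto simp: vertices_def extreme_point_of_def)
  have conv: "convex K"
    using mesh_simplex[OF mesh K(1)] by (rule convex_simplex)
  have "midpoint p ` vertices K \<subseteq> K"
  proof clarify
    fix q assume "q \<in> vertices K"
    then have "closed_segment p q \<subseteq> K"
      using vK K(2) conv by (intro closed_segment_subset) auto
    then show "midpoint p q \<in> K"
      using midpoint_in_closed_segment by blast
  qed
  then have "K' \<subseteq> K"
    unfolding K'_def using conv by (rule hull_minimal)
  moreover have "p \<in> K'"
    unfolding K'_def using K(2) by (intro hull_inc image_eqI[of _ _ p]) auto
  ultimately have "p extreme_point_of K'"
    using K(2) by (auto simp: vertices_def extreme_point_of_def)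
  with \<open>K' \<in> T'\<close> p show "p \<in> interior_nodes D T'"
    by (auto simp: interior_nodes_def vertices_def)
qed

lemma card_interior_nodes_mono:
  assumes "mesh_sequence D T"
  shows "card (interior_nodes D (T 0)) \<le> card (interior_nodes D (T l))"
proof (induction l)
  case (Suc l)
  have "interior_nodes D (T l) \<subseteq> interior_nodes D (T (Suc l))"
    using assms by (intro interior_nodes_refinement) (auto simp: mesh_sequence_def)
  then have "card (interior_nodes D (T l)) \<le> card (interior_nodes D (T (Suc l)))"
    using interior_nodes_finite[OF mesh_sequence_simplicial[OF assms]] by (rule card_mono[rotated])
  with Suc show ?case by simp
qed simp

text \<open>Balls of the size of a mesh cell around the interior nodes cover a fixed ball in \<open>D\<close>.\<close>

lemma interior_nodes_growth:
  fixes D :: "'a::euclidean_space set"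
  assumes T: "mesh_sequence D T" and D: "open D" "D \<noteq> {}"
  obtains C L where "\<And>l. l \<ge> L \<Longrightarrow> 2 ^ (DIM('a) * l) \<le> C * real (card (interior_nodes D (T l)))"
proof -
  define H where "H = Max (diameter ` T 0)"
  obtain \<kappa> where \<kappa>: "\<kappa> > 0" "\<And>l K. K \<in> T l \<Longrightarrow> diameter K \<le> \<kappa> * (H / 2 ^ l)"
    using T by (auto simp: mesh_sequence_def mesh_width_def H_def)
  obtain z r where r: "r > 0" "ball z r \<subseteq> D"
    using D by (metis ex_in_conv openE)
  \<comment> \<open>From level \<open>L\<close> on the cells have diameter below r/2, so every cell
    meeting the half ball has all its vertices in \<open>ball z r\<close>, hence in
    \<open>D\<close>.\<close>
  have "(\<lambda>l. \<kappa> * H * (1 / 2) ^ l) \<longlonglongrightarrow> \<kappa> * H * 0"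
    by (intro tendsto_intros LIMSEQ_power_zero) simp
  then have "\<forall>\<^sub>F l in sequentially. \<kappa> * H * (1 / 2) ^ l < r / 2"
    by (rule order_tendstoD) (use r in simp)
  then obtain L where L: "\<And>l. l \<ge> L \<Longrightarrow> \<kappa> * (H / 2 ^ l) < r / 2"
    by (auto simp: eventually_sequentially power_divide)
  let ?d = "DIM('a)"
  have "2 ^ (?d * l) \<le> (2 * \<kappa> * H / r) ^ ?d * real (card (interior_nodes D (T l)))" if l: "l \<ge> L" for l
  proof -
    let ?N = "interior_nodes D (T l)"
    define \<rho> where "\<rho> = \<kappa> * (H / 2 ^ l)"
    have mesh: "simplicial_mesh D (T l)" using T by (rule mesh_sequence_simplicial)
    have near: "\<exists>p\<in>?N. x \<in> cball p \<rho>" and \<rho>: "\<rho> \<ge> 0" if x: "x \<in> ball z (r / 2)" for x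
    proof -
      have "x \<in> D" using x r by auto
      then obtain K where K: "K \<in> T l" "x \<in> K"
        using mesh_Union[OF mesh] closure_subset[of D] by blast
      have simplex: "int DIM('a) simplex K" using mesh_simplex[OF mesh K(1)] .
      then obtain p where p: "p \<in> vertices K"
        using simplex_vertices(2)[OF simplex] by fastforce
      then have "p \<in> K" by (auto simp: vertices_def extreme_point_of_def)
      moreover have "bounded K" using simplex by (intro compact_imp_bounded compact_simplex)
      ultimately have "dist p x \<le> diameter K"
        using K by (intro diameter_bounded_bound)
      then have dist: "dist p x \<le> \<rho>" using \<kappa>(2)[OF K(1)] by (simp add: \<rho>_def)
      then have "dist p x < r / 2" using L[OF l] unfolding \<rho>_def by linarith
      then have "dist z p < r"
        using x dist_triangle[of z p x] by (simp add: dist_commute)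
      then have "p \<in> ?N"
        using r K p by (auto simp: interior_nodes_def)
      with dist show "\<exists>p\<in>?N. x \<in> cball p \<rho>" by auto
      show "\<rho> \<ge> 0" using dist zero_le_dist[of p x] by linarith
    qed
    have "\<rho> \<ge> 0" using \<rho>[of z] r by simp
    have fin: "finite ?N" using mesh by (rule interior_nodes_finite)
    let ?\<omega> = "unit_ball_vol (real ?d)"
    \<comment> \<open>The half ball has at most the total volume of the covering balls. Cancelling
      the unit ball volume leaves an inequality in which \<open>\<rho>\<close> is proportional to
      2^(-l), which forces at least order 2^(d l) nodes.\<close>
    have "?\<omega> * (r / 2) ^ ?d = measure lborel (ball z (r / 2))"
      using r by (simp add: content_ball)
    also have "\<dots> \<le> measure lborel (\<Union>p\<in>?N. cball p \<rho>)"
      using near fin by (intro measure_mono_fmeasurable fmeasurable.finite_UN)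
        (auto intro!: fmeasurableI emeasure_lborel_cball_finite)
    also have "\<dots> \<le> (\<Sum>p\<in>?N. measure lborel (cball p \<rho>))"
      using fin by (intro measure_UNION_le) auto
    also have "\<dots> = ?\<omega> * (real (card ?N) * \<rho> ^ ?d)"
      using \<open>\<rho> \<ge> 0\<close> by (simp add: content_cball)
    finally have "(r / 2) ^ ?d \<le> real (card ?N) * \<rho> ^ ?d"
      by (simp add: unit_ball_vol_pos)
    also have "\<rho> ^ ?d = (\<kappa> * H) ^ ?d / 2 ^ (?d * l)"
      by (simp add: \<rho>_def power_divide power_mult_distrib power_mult[symmetric] mult.commute)
    finally show ?thesis
      using r by (simp add: power_divide power_mult_distrib field_simps)
  qed
  then show ?thesis by (rule that)
qed

text \<open>The number of cells bounds the number of nodes from above. From below, the volume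
  argument handles large levels, and the finitely many others are absorbed into the constant because
  the node count never falls below its positive initial value.\<close>

lemma fe_dim_same_order:
  fixes D :: "'a::euclidean_space set"
  assumes T: "mesh_sequence D T" and D: "open D" "D \<noteq> {}"
    and basis: "\<And>l. nodal_basis D (T l) (\<phi> l)" and pos: "fe_dim D (T 0) > 0"
  shows "same_order_on UNIV (\<lambda>l. 2 ^ (DIM('a) * l)) (\<lambda>l. real (fe_dim D (T l)))"
proof -
  let ?d = "DIM('a)"
  let ?M = "\<lambda>l. fe_dim D (T l)"
  have M: "?M l = card (interior_nodes D (T l))" for l
    using mesh_sequence_simplicial[OF T] basis by (rule fe_dim_eq_card_interior_nodes)
  have M_pos: "?M l \<ge> 1" for l
    using pos card_interior_nodes_mono[OF T, of l] by (simp add: M)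
  \<comment> \<open>The added 1 makes \<open>A\<close> positive, so that \<open>1 / real A\<close>
    is an admissible constant.\<close>
  define A where "A = card (T 0) * (?d + 1) + 1"
  have upper: "?M l \<le> A * 2 ^ (?d * l)" for l
  proof -
    have "?M l \<le> card (T l) * (?d + 1)"
      unfolding M using mesh_sequence_simplicial[OF T] by (rule card_interior_nodes_le)
    also have "\<dots> \<le> card (T 0) * 2 ^ (?d * l) * (?d + 1)"
      using card_mesh_le[OF T] by (rule mult_right_mono) simp
    also have "\<dots> \<le> A * 2 ^ (?d * l)"
      by (simp add: A_def algebra_simps)
    finally show ?thesis .
  qed
  obtain C L where L: "\<And>l. l \<ge> L \<Longrightarrow> 2 ^ (?d * l) \<le> C * real (?M l)"
    using interior_nodes_growth[OF T D] unfolding M by blast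
  \<comment> \<open>The first summand serves the levels from \<open>L\<close> on; the second serves
    the earlier ones, where \<open>?M l\<close> is at least 1.\<close>
  have lower: "2 ^ (?d * l) \<le> (\<bar>C\<bar> + 2 ^ (?d * L)) * real (?M l)" for l
  proof (cases "l \<ge> L")
    case True
    have "C * real (?M l) \<le> (\<bar>C\<bar> + 2 ^ (?d * L)) * real (?M l)"
      by (intro mult_right_mono) (simp_all add: add_increasing2)
    with L[OF True] show ?thesis by linarith
  next
    case False
    then have "(2::real) ^ (?d * l) \<le> 2 ^ (?d * L)"
      by (intro power_increasing) auto
    also have "\<dots> \<le> (\<bar>C\<bar> + 2 ^ (?d * L)) * 1" by simp
    also have "\<dots> \<le> (\<bar>C\<bar> + 2 ^ (?d * L)) * real (?M l)"
      using M_pos[of l] by (intro mult_left_mono) auto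
    finally show ?thesis .
  qed
  have "real (?M l) \<le> real A * 2 ^ (?d * l)" for l
    using of_nat_mono[OF upper[of l], where 'a = real] by simp
  moreover have "A > 0" unfolding A_def by simp
  then have A: "real A > 0" by simp
  ultimately have "1 / real A * real (?M l) \<le> 2 ^ (?d * l)" for l
    by (simp add: pos_divide_le_eq mult.commute)
  with lower A show ?thesis
    unfolding same_order_on_def
    by (intro exI[of _ "1 / real A"] exI[of _ "\<bar>C\<bar> + 2 ^ (?d * L)"] conjI)
       (auto simp: add_nonneg_pos)
qed

section \<open>Gradients of finite element functions\<close>

context
  fixes D :: "'a::euclidean_space set" and T
  assumes mesh: "simplicial_mesh D T" and D: "open D" "bounded D"
begin

lemma D_lebesgue: "D \<in> sets lebesgue"
  using D(1) by auto

text \<open>\<open>weak_gradient_affine\<close> applies to the bounded open set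
  \<open>interior K \<inter> D\<close>. The guarded form over all of \<open>D\<close> allows the
  statements for finitely many cells to be combined.\<close>

lemma S1_weak_gradient:
  assumes v: "v \<in> S1 D T" "\<And>x. x \<in> K \<Longrightarrow> v x = c + g \<bullet> x"
  shows "AE x in lebesgue_on D. x \<in> interior K \<longrightarrow> weak_gradient D v x = g"
proof -
  have "AE x in lebesgue_on (interior K \<inter> D). weak_gradient D v x = g"
  proof (rule weak_gradient_affine[OF D(1)])
    show "v \<in> H1 D" using v(1) by (auto simp: S1_def H1_0_def)
    show "bounded (interior K \<inter> D)" using D(2) by (rule bounded_subset) auto
  qed (use D v(2) interior_subset[of K] in auto)
  then have "AE x in lebesgue. x \<in> interior K \<inter> D \<longrightarrow> weak_gradient D v x = g"
    using D(1) by (simp add: AE_restrict_space_iff)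
  then have "AE x in lebesgue. x \<in> D \<longrightarrow> x \<in> interior K \<longrightarrow> weak_gradient D v x = g"
    by eventually_elim blast
  then show ?thesis
    using D_lebesgue by (simp add: AE_restrict_space_iff)
qed

lemma weak_gradient_measurable:
  assumes "v \<in> S1 D T"
  shows "weak_gradient D v \<in> borel_measurable (lebesgue_on D)"
proof -
  have "has_weak_gradient D v (weak_gradient D v)"
    using assms someI_ex[of "has_weak_gradient D v"]
    unfolding S1_def H1_0_def H1_def weak_gradient_def by blast
  then show ?thesis by (auto simp: has_weak_gradient_def L2_def)
qed

text \<open>This links the bilinear form to the orthogonality property: cellwise constant gradients
  have a cellwise constant product. Weak gradients being known only almost everywhere, a
  representative \<open>z\<close> bounded at every point is produced.\<close>

lemma S1_gradient_product_S0:
  assumes v: "v \<in> S1 D T" and w: "w \<in> S1 D T"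
  obtains z B where "z \<in> S0 D T" "\<And>x. \<bar>z x\<bar> \<le> B"
    "AE x in lebesgue_on D. weak_gradient D v x \<bullet> weak_gradient D w x = z x"
proof -
  have "\<forall>K\<in>T. \<exists>g c. \<forall>x\<in>K. v x = c + g \<bullet> x" "\<forall>K\<in>T. \<exists>g c. \<forall>x\<in>K. w x = c + g \<bullet> x"
    using v w unfolding S1_def by blast+
  then obtain gv gw where gv: "\<forall>K\<in>T. \<exists>c. \<forall>x\<in>K. v x = c + gv K \<bullet> x"
    and gw: "\<forall>K\<in>T. \<exists>c. \<forall>x\<in>K. w x = c + gw K \<bullet> x"
    by metis
  \<comment> \<open>Using interiors of cells, which are pairwise disjoint, leaves at most one
    nonzero term at each point.\<close>
  define z where "z x = (\<Sum>K\<in>T. (gv K \<bullet> gw K) * indicator (interior K) x)" for x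
  have fin: "finite T" using mesh by (rule mesh_finite)
  have z_eq: "z x = gv K \<bullet> gw K" if "K \<in> T" "x \<in> interior K" for x K
  proof -
    have "z x = (\<Sum>L\<in>T. if L = K then gv K \<bullet> gw K else 0)"
      unfolding z_def
    proof (rule sum.cong)
      fix L assume "L \<in> T"
      show "(gv L \<bullet> gw L) * indicator (interior L) x = (if L = K then gv K \<bullet> gw K else 0)"
      proof (cases "x \<in> interior L")
        case True
        with \<open>L \<in> T\<close> that have "L = K" by (intro mesh_interiors_disjoint[OF mesh])
        with True show ?thesis by simp
      next
        case False
        with that have "L \<noteq> K" by blast
        with False show ?thesis by simp
      qed
    qed simp
    then show ?thesis using fin that by simp
  qed
  define B where "B = (\<Sum>K\<in>T. \<bar>gv K \<bullet> gw K\<bar>)"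
  have z_bound: "\<bar>z x\<bar> \<le> B" for x
    unfolding z_def B_def by (rule order_trans[OF sum_abs sum_mono]) (auto simp: indicator_def)
  have [measurable]: "z \<in> borel_measurable lebesgue"
    unfolding z_def[abs_def]
    by (intro borel_measurable_sum borel_measurable_times borel_measurable_const borel_measurable_indicator) auto
  then have z_meas: "z \<in> borel_measurable (lebesgue_on S)" for S
    by (rule measurable_restrict_space1)
  have "z \<in> L2 D"
  proof -
    interpret finite_measure "lebesgue_on D"
      using D D_lebesgue by (intro finite_measure_lebesgue_on bounded_set_imp_lmeasurable)
    have "integrable (lebesgue_on D) (\<lambda>x. (norm (z x))\<^sup>2)"
    proof (rule integrable_const_bound[of _ "B\<^sup>2"])
      show "AE x in lebesgue_on D. norm ((norm (z x))\<^sup>2) \<le> B\<^sup>2"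
        using power_mono[OF z_bound abs_ge_zero, of _ 2] by (intro AE_I2) simp
    qed (use z_meas in auto)
    then show ?thesis using z_meas by (simp add: L2_def)
  qed
  moreover have "\<exists>c. AE x in lebesgue_on K. z x = c" if K: "K \<in> T" for K
  proof -
    have simplex: "int DIM('a) simplex K" using mesh_simplex[OF mesh K] .
    then have "negligible (frontier K)"
      using convex_simplex negligible_convex_frontier by blast
    then have "AE x in lebesgue. x \<notin> frontier K"
      by (intro AE_not_in) (simp add: negligible_iff_null_sets)
    then have "AE x in lebesgue. x \<in> K \<longrightarrow> z x = gv K \<bullet> gw K"
    proof eventually_elim
      case (elim x)
      then show ?case
        using z_eq[OF K, of x] closure_subset[of K] by (auto simp: frontier_def)
    qed
    moreover have "K \<in> sets lebesgue"
      using closed_simplex[OF simplex] by auto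
    ultimately show ?thesis by (auto simp: AE_restrict_space_iff)
  qed
  ultimately have "z \<in> S0 D T" by (simp add: S0_def)
  moreover have "AE x in lebesgue_on D. weak_gradient D v x \<bullet> weak_gradient D w x = z x"
  proof -
    have "AE x in lebesgue_on D. \<forall>K\<in>T. x \<in> interior K \<longrightarrow> weak_gradient D v x = gv K"
      using gv by (intro AE_finite_allI[OF fin]) (blast intro: S1_weak_gradient[OF v])
    moreover have "AE x in lebesgue_on D. \<forall>K\<in>T. x \<in> interior K \<longrightarrow> weak_gradient D w x = gw K"
      using gw by (intro AE_finite_allI[OF fin]) (blast intro: S1_weak_gradient[OF w])
    ultimately show ?thesis
      using AE_mesh_interior[OF mesh D_lebesgue]
      by eventually_elim (auto simp: z_eq)
  qed
  ultimately show ?thesis using z_bound that by blast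
qed

text \<open>A hat function vanishes at all vertices, hence on the whole, of any cell that does not
  have its node as a vertex. So on every cell one of the two gradients is 0, and the integrand
  vanishes whatever the coefficient \<open>a\<close>.\<close>

lemma stiffness_matrix_eq_0:
  assumes basis: "nodal_basis D T \<phi>"
    and pq: "p \<in> interior_nodes D T" "q \<in> interior_nodes D T"
    and far: "\<And>K. K \<in> T \<Longrightarrow> p \<notin> vertices K \<or> q \<notin> vertices K"
  shows "stiffness_matrix D \<phi> a p q = 0"
proof -
  have fin: "finite T" using mesh by (rule mesh_finite)
  have zero: "AE x in lebesgue_on D. x \<in> interior K \<longrightarrow> weak_gradient D (\<phi> p) x = 0"
    if K: "K \<in> T" and p: "p \<in> interior_nodes D T" "p \<notin> vertices K" for p K
  proof (rule S1_weak_gradient)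
    show \<phi>: "\<phi> p \<in> S1 D T" using basis p by (auto simp: nodal_basis_def)
    obtain c g where cg: "\<And>x. x \<in> K \<Longrightarrow> \<phi> p x = c + g \<bullet> x"
      using \<phi> K by (auto simp: S1_def)
    have hull: "convex hull vertices K = K"
      using mesh_simplex[OF mesh K] by (rule simplex_vertices)
    have "\<phi> p r = 0" if "r \<in> vertices K" for r
    proof (cases "r \<in> D")
      case True
      then have "r \<in> interior_nodes D T" using that K by (auto simp: interior_nodes_def)
      moreover have "r \<noteq> p" using that p by auto
      ultimately show ?thesis using basis p by (auto simp: nodal_basis_def)
    next
      case False
      then show ?thesis using \<phi> by (auto simp: S1_def)
    qed
    then show "\<phi> p x = 0 + 0 \<bullet> x" if "x \<in> K" for x
      using affine_eq_0_on_convex_hull[of "vertices K" "\<phi> p" c g x] cg that hull by simp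
  qed
  have "AE x in lebesgue_on D. \<forall>K\<in>T. x \<in> interior K \<longrightarrow>
      weak_gradient D (\<phi> p) x = 0 \<or> weak_gradient D (\<phi> q) x = 0"
  proof (rule AE_finite_allI[OF fin])
    fix K assume K: "K \<in> T"
    from far[OF K] show "AE x in lebesgue_on D. x \<in> interior K \<longrightarrow>
      weak_gradient D (\<phi> p) x = 0 \<or> weak_gradient D (\<phi> q) x = 0"
    proof
      assume "p \<notin> vertices K"
      from zero[OF K pq(1) this] show ?thesis by eventually_elim blast
    next
      assume "q \<notin> vertices K"
      from zero[OF K pq(2) this] show ?thesis by eventually_elim blast
    qed
  qed
  with AE_mesh_interior[OF mesh D_lebesgue]
  have "AE x in lebesgue_on D. a x * (weak_gradient D (\<phi> p) x \<bullet> weak_gradient D (\<phi> q) x) = 0"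
    by eventually_elim auto
  then show ?thesis
    unfolding stiffness_matrix_def bilinear_form_def by (rule integral_eq_zero_AE)
qed

lemma nonzero_entries_subset:
  assumes "nodal_basis D T \<phi>"
  shows "nonzero_entries D T \<phi> a \<subseteq> (\<Union>K\<in>T. vertices K \<times> vertices K)"
  using stiffness_matrix_eq_0[OF assms] unfolding nonzero_entries_def by blast

lemma card_nonzero_entries_le:
  assumes "nodal_basis D T \<phi>"
  shows "card (nonzero_entries D T \<phi> a) \<le> card T * (DIM('a) + 1)\<^sup>2"
proof -
  have fin: "finite T" using mesh by (rule mesh_finite)
  have "card (nonzero_entries D T \<phi> a) \<le> card (\<Union>K\<in>T. vertices K \<times> vertices K)"
    using nonzero_entries_subset[OF assms] fin simplex_vertices(1)[OF mesh_simplex[OF mesh]]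
    by (intro card_mono) auto
  also have "\<dots> \<le> (\<Sum>K\<in>T. card (vertices K \<times> vertices K))"
    using fin by (rule card_UN_le)
  also have "\<dots> = card T * (DIM('a) + 1)\<^sup>2"
    by (simp add: simplex_vertices(2)[OF mesh_simplex[OF mesh]] card_cartesian_product power2_eq_square)
  finally show ?thesis .
qed

end

section \<open>Truncation of the coefficient\<close>

text \<open>Monotonicity of the level makes the index set closed downwards, hence an initial
  segment; the bijection determines its length.\<close>

lemma levelwise_enumeration_below:
  assumes e: "levelwise_enumeration J e" and J: "\<And>n. finite (J n)"
  shows "{j. fst (e j) < N} = {..<\<Sum>n<N. card (J n)}"
proof -
  define A where "A = {j. fst (e j) < N}"
  have bij: "bij_betw e UNIV (Sigma UNIV J)" and mono: "mono (\<lambda>j. fst (e j))"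
    using e by (auto simp: levelwise_enumeration_def)
  have "e ` A = {p \<in> range e. fst p < N}"
    by (auto simp: A_def)
  also have "\<dots> = Sigma {..<N} J"
    using bij by (auto simp: bij_betw_def)
  finally have "e ` A = Sigma {..<N} J" .
  then have bijA: "bij_betw e A (Sigma {..<N} J)"
    using bij unfolding bij_betw_def by (auto intro: inj_on_subset)
  have finA: "finite A"
    using bij_betw_finite[OF bijA] J by auto
  have "card A = card (Sigma {..<N} J)"
    using bijA by (rule bij_betw_same_card)
  also have "\<dots> = (\<Sum>n<N. card (J n))"
    using J by (simp add: card_SigmaI)
  finally have cardA: "card A = (\<Sum>n<N. card (J n))" .
  have down: "i \<in> A" if "i \<le> j" "j \<in> A" for i j
    using monoD[OF mono that(1)] that(2) by (simp add: A_def)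
  have "A = {..<card A}"
  proof (cases "A = {}")
    case False
    have "A \<subseteq> {..Max A}"
      using finA by auto
    moreover have "{..Max A} \<subseteq> A"
      using down[OF _ Max_in[OF finA False]] by blast
    ultimately have "A = {..Max A}" ..
    then show ?thesis
      by (metis card_atMost lessThan_Suc_atMost)
  qed auto
  then show ?thesis by (simp add: A_def[symmetric] cardA)
qed

text \<open>For \<open>k \<ge> 1\<close> the subtraction in \<open>l + k - 1\<close> is not cut off
  at 0, so the closed range of levels is the half-open one.\<close>

lemma truncation_dim_lessThan:
  "k \<ge> 1 \<Longrightarrow> truncation_dim k J l = (\<Sum>n<l + k. card (J n))"
  unfolding truncation_dim_def by (rule sum.cong) auto

text \<open>The level \<open>l\<close> term alone gives the lower bound. The upper bound is a
  geometric sum with ratio q = 2^d >= 2, and the shift by \<open>k\<close> costs the constant factor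
  q^k.\<close>

lemma truncation_dim_same_order:
  assumes J: "same_order_on UNIV (\<lambda>n. real (card (J n))) (\<lambda>n. 2 ^ (d * n))"
    and d: "d \<ge> 1" and k: "k \<ge> 1"
  shows "same_order_on UNIV (\<lambda>l. real (truncation_dim k J l)) (\<lambda>l. 2 ^ (d * l))"
proof -
  obtain c1 c2 where c: "c1 > 0" "c2 > 0"
    "\<And>n. c1 * 2 ^ (d * n) \<le> real (card (J n))" "\<And>n. real (card (J n)) \<le> c2 * 2 ^ (d * n)"
    using J by (auto simp: same_order_on_def)
  define q :: real where "q = 2 ^ d"
  have "q \<ge> 2 ^ 1" unfolding q_def using d by (intro power_increasing) auto
  then have q: "q \<ge> 2" by simp
  have pow: "2 ^ (d * n) = q ^ n" for n by (simp add: q_def power_mult)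
  have lower: "c1 * q ^ l \<le> real (truncation_dim k J l)" for l
  proof -
    have "card (J l) \<le> (\<Sum>n<l + k. card (J n))"
      using k by (intro member_le_sum) auto
    then have "real (card (J l)) \<le> real (truncation_dim k J l)"
      unfolding truncation_dim_lessThan[OF k] of_nat_le_iff .
    with c(3)[of l] show ?thesis by (simp add: pow)
  qed
  have upper: "real (truncation_dim k J l) \<le> c2 * q ^ k * q ^ l" for l
  proof -
    have "real (truncation_dim k J l) \<le> (\<Sum>n<l + k. c2 * q ^ n)"
      unfolding truncation_dim_lessThan[OF k] of_nat_sum using c(4) by (intro sum_mono) (simp add: pow)
    also have "\<dots> = c2 * ((q ^ (l + k) - 1) / (q - 1))"
      using q by (simp add: sum_distrib_left[symmetric] geometric_sum)
    also have "(q ^ (l + k) - 1) / (q - 1) \<le> q ^ (l + k) / 1"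
      using q by (intro frac_le) (auto intro: order_trans[OF _ one_le_power])
    finally show ?thesis
      using c(2) by (simp add: power_add mult_ac)
  qed
  show ?thesis
    unfolding same_order_on_def
  proof (intro exI conjI ballI)
    show "c1 > 0" "c2 * q ^ k > 0" using c q by auto
  qed (use lower upper in \<open>auto simp: pow\<close>)
qed

text \<open>No integrability of \<open>h\<close> is needed: the Bochner integral of a nonintegrable function is \<open>0\<close>.\<close>

lemma integral_add_null:
  fixes h d :: "'b \<Rightarrow> real"
  assumes "integrable M d" "integral\<^sup>L M d = 0"
  shows "(\<integral>x. h x + d x \<partial>M) = (\<integral>x. h x \<partial>M)"
proof (cases "integrable M h")
  case True
  then show ?thesis using assms by simp
next
  case False
  have "\<not> integrable M (\<lambda>x. h x + d x)"
  proof
    assume "integrable M (\<lambda>x. h x + d x)"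
    from Bochner_Integration.integrable_diff[OF this assms(1)] False show False by simp
  qed
  with False show ?thesis by (simp add: not_integrable_integral_eq)
qed

section \<open>Exchanging the coefficient series with the integral\<close>

context
  fixes D :: "'a::euclidean_space set" and \<psi> :: "nat \<Rightarrow> 'a \<Rightarrow> real"
  assumes D: "open D" "D \<noteq> {}" "bounded D"
    and psi_summable: "(\<Sum>j. Linf_norm D (\<psi> j)) < \<infinity>"
begin

text \<open>\<open>D\<close> is open and nonempty, so it has positive measure and the essential
  supremum of 0 is 0. For a nonmeasurable function \<open>esssup\<close> takes its default value,
  the top element.\<close>

lemma Linf_norm_nonneg: "0 \<le> Linf_norm D (v :: 'a \<Rightarrow> real)"
proof (cases "(\<lambda>x. ereal \<bar>v x\<bar>) \<in> borel_measurable (lebesgue_on D)")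
  case True
  have "emeasure (lebesgue_on D) (space (lebesgue_on D)) = emeasure lebesgue D"
    using D(1) by (subst emeasure_restrict_space) auto
  moreover have "emeasure lebesgue D \<noteq> 0"
  proof
    assume "emeasure lebesgue D = 0"
    then have "negligible D"
      using D(1) by (auto simp: negligible_iff_null_sets null_sets_def)
    then show False using open_not_negligible[OF D(1,2)] by blast
  qed
  ultimately have "0 = esssup (lebesgue_on D) (\<lambda>x. 0 :: ereal)"
    by (simp add: esssup_const)
  also have "\<dots> \<le> Linf_norm D v"
    unfolding Linf_norm_def by (rule esssup_mono) auto
  finally show ?thesis .
qed (simp add: Linf_norm_def esssup_non_measurable)

lemma Linf_norm_finite: "Linf_norm D (\<psi> j) < \<infinity>"
  using suminf_PInfty[of "\<lambda>j. Linf_norm D (\<psi> j)" j] Linf_norm_nonneg psi_summable by auto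

lemma Linf_norm_summable: "summable (\<lambda>j. real_of_ereal (Linf_norm D (\<psi> j)))"
  using Linf_norm_nonneg psi_summable by (intro summable_real_of_ereal) auto

lemma AE_le_Linf_norm: "AE x in lebesgue_on D. \<bar>\<psi> j x\<bar> \<le> real_of_ereal (Linf_norm D (\<psi> j))"
proof -
  have eq: "Linf_norm D (\<psi> j) = ereal (real_of_ereal (Linf_norm D (\<psi> j)))"
    using Linf_norm_finite[of j] Linf_norm_nonneg[of "\<psi> j"] by (simp add: ereal_real)
  have "AE x in lebesgue_on D. ereal \<bar>\<psi> j x\<bar> \<le> Linf_norm D (\<psi> j)"
    unfolding Linf_norm_def by (rule esssup_AE)
  then show ?thesis
    by eventually_elim (metis eq ereal_less_eq(3))
qed

text \<open>The two integrands differ by the tail of the series times the gradient product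
  \<open>z\<close>. Each tail term integrates to 0 by orthogonality, and summability of the sup
  norms with boundedness of \<open>z\<close> allows integration term by term.\<close>

lemma bilinear_form_truncate:
  assumes psi[measurable]: "\<And>j. \<psi> j \<in> borel_measurable (lebesgue_on D)"
    and abar[measurable]: "abar \<in> borel_measurable (lebesgue_on D)"
    and mesh: "simplicial_mesh D T" and v: "v \<in> S1 D T" and w: "w \<in> S1 D T"
    and orth: "\<And>j z. j \<ge> s \<Longrightarrow> z \<in> S0 D T \<Longrightarrow> (\<integral>x. \<psi> j x * z x \<partial>lebesgue_on D) = 0"
    and y: "y \<in> param_domain"
  shows "bilinear_form D (coefficient abar \<psi> y) v w
       = bilinear_form D (coefficient abar \<psi> (truncate s y)) v w"
proof -
  interpret finite_measure "lebesgue_on D"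
    using D by (intro finite_measure_lebesgue_on bounded_set_imp_lmeasurable) auto
  obtain z B where z: "z \<in> S0 D T" "\<And>x. \<bar>z x\<bar> \<le> B"
    and z_eq: "AE x in lebesgue_on D. weak_gradient D v x \<bullet> weak_gradient D w x = z x"
    using S1_gradient_product_S0[OF mesh D(1,3) v w] by blast
  have [measurable]: "z \<in> borel_measurable (lebesgue_on D)"
    using z(1) by (auto simp: S0_def L2_def)
  note [measurable] = weak_gradient_measurable[OF mesh D(1,3) v] weak_gradient_measurable[OF mesh D(1,3) w]
  have "B \<ge> 0" using z(2)[of undefined] by (meson abs_ge_zero order_trans)
  define b where "b j = real_of_ereal (Linf_norm D (\<psi> j))" for j
  have b: "summable b" "\<And>j. b j \<ge> 0" "AE x in lebesgue_on D. \<forall>j. \<bar>\<psi> j x\<bar> \<le> b j"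
    using Linf_norm_summable Linf_norm_nonneg AE_le_Linf_norm
    by (auto simp: b_def[abs_def] AE_all_countable real_of_ereal_pos)
  have y_bound: "\<bar>y j\<bar> \<le> 1" for j
    using y by (auto simp: param_domain_def abs_le_iff dest: spec[of _ j])
  \<comment> \<open>Masking the first \<open>s\<close> coefficients by 0, instead of shifting the
    index, makes \<open>y\<close> the termwise sum of its truncation and this tail.\<close>
  define t where "t j x = (if j < s then 0 else y j) * \<psi> j x * z x" for j x
  have [measurable]: "t j \<in> borel_measurable (lebesgue_on D)" for j
    unfolding t_def[abs_def] by measurable
  have t_bound: "AE x in lebesgue_on D. \<forall>j. \<bar>t j x\<bar> \<le> b j * B"
    using b(3)
  proof eventually_elim
    case (elim x)
    have "\<bar>t j x\<bar> \<le> 1 * b j * B" for j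
      unfolding t_def abs_mult using y_bound elim z(2) b(2) by (intro mult_mono) auto
    then show ?case by simp
  qed
  have t_int: "integrable (lebesgue_on D) (t j)" for j
    by (rule integrable_const_bound[of _ "b j * B"]) (use t_bound in auto)
  \<comment> \<open>On a domain of finite measure the pointwise bounds \<open>b j * B\<close> yield
    a summable bound for the integrals.\<close>
  have t_norm_summable: "summable (\<lambda>j. \<integral>x. norm (t j x) \<partial>lebesgue_on D)"
  proof (rule summable_comparison_test')
    show "summable (\<lambda>j. b j * B * measure (lebesgue_on D) (space (lebesgue_on D)))"
      using b(1) by (intro summable_mult2)
    have "(\<integral>x. norm (t j x) \<partial>lebesgue_on D) \<le> (\<integral>x. b j * B \<partial>lebesgue_on D)" for j
      using t_int t_bound by (intro integral_mono_AE) auto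
    then show "norm (\<integral>x. norm (t j x) \<partial>lebesgue_on D)
        \<le> b j * B * measure (lebesgue_on D) (space (lebesgue_on D))" for j
      by (simp add: mult_ac)
  qed
  have t_AE_summable: "AE x in lebesgue_on D. summable (\<lambda>j. norm (t j x))"
    using t_bound
  proof eventually_elim
    case (elim x)
    show ?case
      by (rule summable_comparison_test'[OF summable_mult2[OF b(1), of B]]) (use elim in auto)
  qed
  have t_0: "(\<integral>x. t j x \<partial>lebesgue_on D) = 0" for j
    using orth[OF _ z(1), of j] by (cases "j < s") (simp_all add: t_def mult.assoc)
  define d where "d x = (\<Sum>j. t j x)" for x
  have d: "integrable (lebesgue_on D) d" "(\<integral>x. d x \<partial>lebesgue_on D) = 0"
    using integrable_suminf[OF t_int t_AE_summable t_norm_summable]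
      integral_suminf[OF t_int t_AE_summable t_norm_summable] t_0
    by (simp_all add: d_def[abs_def])
  let ?g = "\<lambda>x. weak_gradient D v x \<bullet> weak_gradient D w x"
  let ?a = "coefficient abar \<psi>"
  have a_meas [measurable]: "?a y \<in> borel_measurable (lebesgue_on D)" for y
    unfolding coefficient_def[abs_def] by measurable
  have "bilinear_form D (?a y) v w = (\<integral>x. ?a (truncate s y) x * ?g x + d x \<partial>lebesgue_on D)"
    unfolding bilinear_form_def
  proof (rule integral_cong_AE)
    show "AE x in lebesgue_on D. ?a y x * ?g x = ?a (truncate s y) x * ?g x + d x"
      using z_eq b(3)
    proof eventually_elim
      case (elim x)
      \<comment> \<open>Both partial series have to converge before \<open>suminf\<close> may be
        split additively.\<close>
      have summ: "summable (\<lambda>j. c j * \<psi> j x)" if "\<And>j. \<bar>c j\<bar> \<le> 1" for c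
      proof (rule summable_comparison_test'[OF b(1)])
        show "norm (c j * \<psi> j x) \<le> b j" for j
          using mult_mono[OF that[of j], of "\<bar>\<psi> j x\<bar>" "b j"] elim by (simp add: abs_mult)
      qed
      have 1: "summable (\<lambda>j. truncate s y j * \<psi> j x)"
        and 2: "summable (\<lambda>j. (if j < s then 0 else y j) * \<psi> j x)"
        using y_bound by (auto intro!: summ simp: truncate_def)
      have "(\<Sum>j. y j * \<psi> j x)
          = (\<Sum>j. truncate s y j * \<psi> j x + (if j < s then 0 else y j) * \<psi> j x)"
        by (rule suminf_cong) (simp add: truncate_def)
      also have "\<dots> = (\<Sum>j. truncate s y j * \<psi> j x) + (\<Sum>j. (if j < s then 0 else y j) * \<psi> j x)"
        using suminf_add[OF 1 2] by simp
      finally have "?a y x * z x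
          = ?a (truncate s y) x * z x + (\<Sum>j. (if j < s then 0 else y j) * \<psi> j x) * z x"
        by (simp add: coefficient_def algebra_simps)
      also have "(\<Sum>j. (if j < s then 0 else y j) * \<psi> j x) * z x = d x"
        using suminf_mult2[OF 2, of "z x"] by (simp add: d_def t_def)
      finally show ?case using elim by simp
    qed
    show "(\<lambda>x. ?a (truncate s y) x * ?g x + d x) \<in> borel_measurable (lebesgue_on D)"
      using d(1) by measurable
  qed measurable
  also have "\<dots> = bilinear_form D (?a (truncate s y)) v w"
    unfolding bilinear_form_def using d by (rule integral_add_null)
  finally show ?thesis .
qed

end

text \<open>Taking \<open>l = n\<close> in the second clause of the property places
  \<open>\<psi> n m\<close> in a finite element space, whose elements are measurable.\<close>

lemma k_orthogonality_measurable:
  assumes "k_orthogonality k D T J \<psi>" "k \<in> {1, 2}" "m \<in> J n"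
  shows "\<psi> n m \<in> borel_measurable (lebesgue_on D)"
proof -
  have "\<psi> n m \<in> S_space (k - 1) D (T (n + k - 1))"
    using assms unfolding k_orthogonality_def by auto
  then show ?thesis
    by (auto simp: S_space_def S0_def S1_def H1_0_def H1_def L2_def split: if_splits)
qed

section \<open>Truncation levels, Galerkin solutions and matrix costs combined\<close>

theorem theorem5:
  fixes D :: "'a::euclidean_space set"
    and T :: "nat \<Rightarrow> 'a set set"
    and \<phi> :: "nat \<Rightarrow> 'a \<Rightarrow> 'a \<Rightarrow> real"
    and f :: "('a \<Rightarrow> real) \<Rightarrow> real"
    and k :: nat
    and J :: "nat \<Rightarrow> 'm set"
    and \<psi> :: "nat \<Rightarrow> 'm \<Rightarrow> 'a \<Rightarrow> real"
    and e :: "nat \<Rightarrow> nat \<times> 'm"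
    and abar :: "'a \<Rightarrow> real"
    and amin amax :: real
  defines "a \<equiv> coefficient abar (enumerated \<psi> e)"
    and "M \<equiv> \<lambda>l. fe_dim D (T l)"
    and "s \<equiv> truncation_dim k J"
    and "u \<equiv> \<lambda>l y. fe_solution D (T l) f (coefficient abar (enumerated \<psi> e) y)"
    and "nonzeros \<equiv> \<lambda>l y. nonzero_entries D (T l) (\<phi> l) (coefficient abar (enumerated \<psi> e) y)"
  assumes dimension: "DIM('a) \<in> {1, 2, 3}"
    and domain: "lipschitz_domain D" "polyhedral D" "bounded D"
    and meshes: "mesh_sequence D T"
    and nontrivial: "M 0 > 0"
    and hat_basis: "\<And>l. nodal_basis D (T l) (\<phi> l)"
    and rhs: "f \<in> dual_H1_0 D"
    and k: "k \<in> {1, 2}"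
    and J_finite: "\<And>n. finite (J n)"
    and J_card: "same_order_on UNIV (\<lambda>n. real (card (J n))) (\<lambda>n. 2 ^ (DIM('a) * n))"
    and multires: "multiresolution_family D T J \<psi>"
    and orthogonality: "k_orthogonality k D T J \<psi>"
    and enumeration: "levelwise_enumeration J e"
    and abar: "abar \<in> Linf D"
    and psi_summable: "(\<Sum>j. Linf_norm D (enumerated \<psi> e j)) < \<infinity>"
    and ellipticity: "0 < amin"
      "\<And>x y. x \<in> D \<Longrightarrow> y \<in> param_domain \<Longrightarrow> amin \<le> a y x \<and> a y x \<le> amax"
  shows "same_order_on UNIV (\<lambda>l. real (s l)) (\<lambda>l. 2 ^ (DIM('a) * l)) \<and>
    same_order_on UNIV (\<lambda>l. 2 ^ (DIM('a) * l)) (\<lambda>l. real (M l)) \<and>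
    (\<forall>l. \<forall>y\<in>param_domain. u l y = u l (truncate (s l) y)) \<and>
    (\<forall>y\<in>param_domain. (\<lambda>l. real (card (nonzeros l y))) \<in> O(\<lambda>l. real (M l))) \<and>
    (\<forall>y\<in>param_domain. \<forall>cost :: nat \<Rightarrow> 'a \<Rightarrow> 'a \<Rightarrow> nat.
       (\<exists>C. \<forall>\<^sub>F l in sequentially.
          \<forall>(p, q)\<in>nonzeros l y. real (cost l p q) \<le> C * ln (real (M l))) \<longrightarrow>
       (\<lambda>l. real (\<Sum>(p, q)\<in>nonzeros l y. cost l p q)) \<in> O(\<lambda>l. real (M l) * ln (real (M l))))"
proof -
  have D: "open D" "D \<noteq> {}" "bounded D"
    using domain by (auto simp: lipschitz_domain_def)
  have k1: "k \<ge> 1" using k by auto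
  have mesh: "simplicial_mesh D (T l)" for l
    using meshes by (rule mesh_sequence_simplicial)
  have s_order: "same_order_on UNIV (\<lambda>l. real (s l)) (\<lambda>l. 2 ^ (DIM('a) * l))"
    unfolding s_def using J_card _ k1 by (rule truncation_dim_same_order) (simp add: Suc_leI)
  have M_order: "same_order_on UNIV (\<lambda>l. 2 ^ (DIM('a) * l)) (\<lambda>l. real (M l))"
    unfolding M_def
    using meshes D(1,2) hat_basis nontrivial[unfolded M_def] by (rule fe_dim_same_order)
  have bij: "bij_betw e UNIV (Sigma UNIV J)"
    using enumeration by (simp add: levelwise_enumeration_def)
  have eJ: "snd (e j) \<in> J (fst (e j))" for j
    using bij_betwE[OF bij] by (metis UNIV_I mem_Sigma_iff prod.collapse)
  have psi_meas: "enumerated \<psi> e j \<in> borel_measurable (lebesgue_on D)" for j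
    unfolding enumerated_def using orthogonality k eJ by (rule k_orthogonality_measurable)
  \<comment> \<open>Indices start at 0, so the first \<open>s l\<close> of them are exactly those of
    level below \<open>l + k\<close>; all later ones fall under the orthogonality clause for mesh
    level \<open>l\<close>.\<close>
  have s_level: "fst (e j) \<ge> l + k" if "j \<ge> s l" for j l
  proof -
    have "j \<notin> {j. fst (e j) < l + k}"
      using that levelwise_enumeration_below[OF enumeration J_finite, of "l + k"]
      by (simp add: s_def truncation_dim_lessThan[OF k1])
    then show ?thesis by simp
  qed
  have orth: "(\<integral>x. enumerated \<psi> e j x * z x \<partial>lebesgue_on D) = 0"
    if "j \<ge> s l" "z \<in> S0 D (T l)" for j l z
    using orthogonality s_level[OF that(1)] eJ[of j] that(2)
    unfolding k_orthogonality_def enumerated_def by blast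
  have abar_meas: "abar \<in> borel_measurable (lebesgue_on D)"
    using abar by (simp add: Linf_def)
  have u_eq: "u l y = u l (truncate (s l) y)" if y: "y \<in> param_domain" for l y
  proof -
    have "bilinear_form D (coefficient abar (enumerated \<psi> e) y) v w
        = bilinear_form D (coefficient abar (enumerated \<psi> e) (truncate (s l) y)) v w"
      if "v \<in> S1 D (T l)" "w \<in> S1 D (T l)" for v w
      using bilinear_form_truncate[OF D psi_summable psi_meas abar_meas mesh that orth y] .
    \<comment> \<open>\<open>fe_solution\<close> is a definite description, and equal bilinear forms
      on the finite element space make the two describing predicates equal.\<close>
    then show ?thesis
      unfolding u_def fe_solution_def by (intro arg_cong[where f = The]) auto
  qed
  obtain c where c: "c > 0" "\<And>l. 2 ^ (DIM('a) * l) \<le> c * real (M l)"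
    using M_order by (auto simp: same_order_on_def)
  \<comment> \<open>There are at most |T_0| 2^(d l) cells with (d + 1)^2 vertex pairs each, and
    \<open>c\<close> converts 2^(d l) into \<open>M l\<close>.\<close>
  define C where "C = real (card (T 0) * (DIM('a) + 1)\<^sup>2) * c"
  have nonzeros_bound: "real (card (nonzeros l y)) \<le> C * real (M l)" for l y
  proof -
    have "card (nonzeros l y) \<le> card (T l) * (DIM('a) + 1)\<^sup>2"
      unfolding nonzeros_def using mesh D(1,3) hat_basis by (rule card_nonzero_entries_le)
    also have "\<dots> \<le> card (T 0) * 2 ^ (DIM('a) * l) * (DIM('a) + 1)\<^sup>2"
      using card_mesh_le[OF meshes] by (rule mult_right_mono) simp
    finally have "real (card (nonzeros l y)) \<le> real (card (T 0) * 2 ^ (DIM('a) * l) * (DIM('a) + 1)\<^sup>2)"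
      by (rule of_nat_mono)
    also have "\<dots> = real (card (T 0) * (DIM('a) + 1)\<^sup>2) * 2 ^ (DIM('a) * l)"
      by simp
    also have "\<dots> \<le> real (card (T 0) * (DIM('a) + 1)\<^sup>2) * (c * real (M l))"
      using c(2) by (rule mult_left_mono) simp
    finally show ?thesis by (simp add: C_def mult.assoc)
  qed
  have nonzeros_O: "(\<lambda>l. real (card (nonzeros l y))) \<in> O(\<lambda>l. real (M l))" for y
    by (rule bigoI[of _ C]) (use nonzeros_bound in auto)
  have cost_O: "(\<lambda>l. real (\<Sum>(p, q)\<in>nonzeros l y. cost l p q)) \<in> O(\<lambda>l. real (M l) * ln (real (M l)))"
    if "\<forall>\<^sub>F l in sequentially. \<forall>(p, q)\<in>nonzeros l y. real (cost l p q) \<le> C' * ln (real (M l))"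
    for y C' and cost :: "nat \<Rightarrow> 'a \<Rightarrow> 'a \<Rightarrow> nat"
  \<comment> \<open>The given constant \<open>C'\<close> may be negative, so its absolute value
    enters the bound.\<close>
  proof (rule bigoI[of _ "C * \<bar>C'\<bar>"])
    show "\<forall>\<^sub>F l in sequentially. norm (real (\<Sum>(p, q)\<in>nonzeros l y. cost l p q))
        \<le> C * \<bar>C'\<bar> * norm (real (M l) * ln (real (M l)))"
      using that
    proof eventually_elim
      case (elim l)
      have "real (\<Sum>(p, q)\<in>nonzeros l y. cost l p q) = (\<Sum>(p, q)\<in>nonzeros l y. real (cost l p q))"
        by (simp add: case_prod_unfold)
      also have "\<dots> \<le> (\<Sum>(p, q)\<in>nonzeros l y. \<bar>C'\<bar> * \<bar>ln (real (M l))\<bar>)"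
        using elim abs_ge_self[of "C' * ln (real (M l))"]
        by (intro sum_mono) (force simp: abs_mult)
      also have "\<dots> = real (card (nonzeros l y)) * (\<bar>C'\<bar> * \<bar>ln (real (M l))\<bar>)"
        by (simp add: case_prod_unfold)
      also have "\<dots> \<le> C * real (M l) * (\<bar>C'\<bar> * \<bar>ln (real (M l))\<bar>)"
        using nonzeros_bound by (rule mult_right_mono) simp
      finally show ?case
        unfolding real_norm_def abs_of_nat by (simp add: abs_mult mult_ac)
    qed
  qed
  show ?thesis
    using s_order M_order u_eq nonzeros_O cost_O by blast
qed

end
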